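(* Let $\mathcal H$ be a real or complex Hilbert space, let $m\ge 1$ be an integer, and let $(U_i)_{1\le i\le m}$ be closed vector subspaces of $\mathcal H$ with respective orthogonal projectors $(P_i)_{1\le i\le m}$. With the notation $U_{i+}$, $P_{i+}$, $P_{i+}^\bot$, $P_i^\bot$, $d_S$, $\mathsf c(\cdot,\cdot)$ of the context, the following are equivalent. (i) $(U_i)_{1\le i\le m}$ satisfies the inverse best approximation property. (ii) For every $i\in\{1,\ldots,m-1\}$ and every $u_i\in U_i$ there exists $x\in\mathcal H$ such that $P_ix=u_i$ and $P_jx=0$ for every $j\in\{i+1,\ldots,m\}$. (iii) For every $i\in\{1,\ldots,m-1\}$, $P_i(U_{i+}^\bot)=U_i$. (iv) For every $i\in\{1,\ldots,m-1\}$, $U_i^\bot+U_{i+}^\bot=\mathcal H$. (v) The subspaces $(U_i)_{1\le i\le m}$ are linearly independent and, for every $i\in\{1,\ldots,m-1\}$, there exists $\gamma_i\in\,]0,+\infty[$ such that $d_{U_i^\bot\cap U_{i+}^\bot}\le\gamma_i\,(d_{U_i^\bot}+d_{U_{i+}^\bot})$ pointwise on $\mathcal H$. (vi) The subspaces $(U_i)_{1\le i\le m}$ are linearly independent and, for every $i\in\{1,\ldots,m-1\}$, $U_i+U_{i+}$ is closed. (vii) The subspaces $(U_i)_{1\le i\le m}$ are linearly independent and, for every $i\in\{1,\ldots,m-1\}$, $\mathsf c(U_i,U_{i+})<1$. (viii) For every $i\in\{1,\ldots,m-1\}$ there exists $\gamma_i\in[1,+\infty[$ such that $\|u_i\|\le\gamma_i\|P_{i+}^\bot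 u_i\|$ for every $u_i\in U_i$. (ix) For every $i\in\{1,\ldots,m-1\}$ there exists $\gamma_i\in[2,+\infty[$ such that $\|x\|\le\gamma_i(\|P_i^\bot x\|+\|P_{i+}^\bot x\|)$ for every $x\in\mathcal H$. (x) For every $i\in\{1,\ldots,m-1\}$, $\|P_iP_{i+}\|<1$.
   Context: The family $(U_i)_{1\le i\le m}$ satisfies the inverse best approximation property (IBAP) if for every $(u_1,\ldots,u_m)\in U_1\times\cdots\times U_m$ there exists $x\in\mathcal H$ such that $P_ix=u_i$ for every $i\in\{1,\ldots,m\}$. For $i\in\{0,\ldots,m-1\}$: $U_{i+}=\sum_{j=i+1}^mU_j$ (algebraic sum, not assumed closed), $P_{i+}$ is the orthogonal projector onto the closure $\overline{U_{i+}}$, and $P_{i+}^\bot$ is the orthogonal projector onto $U_{i+}^\bot$. $P_i^\bot$ is the orthogonal projector onto $U_i^\bot$. $d_S$ denotes the distance function to a closed affine subspace $S$. The subspaces $(U_i)_{1\le i\le m}$ are linearly independent if $u_i\in U_i$ for all $i$ and $\sum_{i=1}^mu_i=0$ imply $u_i=0$ for all $i$. For vector subspaces $U,V$ of $\mathcal H$, $\mathsf c(U,V)=\sup\{|\langle x\mid y\rangle| : x\in U\cap(U\cap V)^\bot,\ y\in V\cap(U\cap V)^\bot,\ \|x\|\le1,\ \|y\|\le1\}$ (the cosine of the angle determined by $U$ and $V$). *)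

theory Defs
  imports "HOL-Analysis.Analysis" "HOL-Library.Set_Algebras"
begin

(* The scalar field: a copy of the reals or of the complex numbers, given by an isometric
   embedding of fields into the complex numbers. *)
class real_or_complex = real_normed_field +
  fixes to_complex :: "'a \<Rightarrow> complex"
  assumes to_complex_add: "to_complex (a + b) = to_complex a + to_complex b"
    and to_complex_mult: "to_complex (a * b) = to_complex a * to_complex b"
    and to_complex_scaleR: "to_complex (r *\<^sub>R a) = r *\<^sub>R to_complex a"
    and norm_to_complex: "norm (to_complex a) = norm a"
    and range_to_complex: "range to_complex = \<real> \<or> range to_complex = UNIV"

instantiation real :: real_or_complex
begin
definition to_complex_real :: "real \<Rightarrow> complex" where "to_complex_real = complex_of_real"
instance
  by standard (auto simp: to_complex_real_def Reals_def scaleR_conv_of_real)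
end

instantiation complex :: real_or_complex
begin
definition to_complex_complex :: "complex \<Rightarrow> complex" where "to_complex_complex = (\<lambda>z. z)"
instance
  by standard (auto simp: to_complex_complex_def)
end

(* A real or complex Hilbert space: the complete norm of the type is the one induced by the
   inner product ip, which is linear in its first argument. *)
locale hilbert_space = vector_space scale
  for scale :: "'k::real_or_complex \<Rightarrow> 'a::{real_normed_vector,complete_space} \<Rightarrow> 'a" +
  fixes ip :: "'a \<Rightarrow> 'a \<Rightarrow> 'k"
  assumes scale_of_real: "scale (of_real r) x = r *\<^sub>R x"
    and ip_add_left: "ip (x + y) z = ip x z + ip y z"
    and ip_scale_left: "ip (scale a x) y = a * ip x y"
    and ip_commute: "to_complex (ip y x) = cnj (to_complex (ip x y))"
    and ip_self: "ip x x = of_real ((norm x)\<^sup>2)"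

lemma hilbert_space_real:
  "hilbert_space (scaleR :: real \<Rightarrow> 'a::{real_inner,complete_space} \<Rightarrow> 'a) inner"
  by unfold_locales
    (auto simp: inner_add_left inner_add_right inner_commute to_complex_real_def power2_norm_eq_inner
      scaleR_right_distrib scaleR_left_distrib)

lemma hilbert_space_complex: "hilbert_space ((*) :: complex \<Rightarrow> complex \<Rightarrow> complex) (\<lambda>x y. x * cnj y)"
  by unfold_locales
    (auto simp: algebra_simps to_complex_complex_def scaleR_conv_of_real simp flip: complex_norm_square)

definition orthocomp :: "('a \<Rightarrow> 'a \<Rightarrow> 'k::zero) \<Rightarrow> 'a set \<Rightarrow> 'a set" where
  "orthocomp ip S = {x. \<forall>y\<in>S. ip x y = 0}"

(* Meaningful when S is a closed vector subspace, where the point p exists and is unique. *)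
definition proj :: "('a::ab_group_add \<Rightarrow> 'a \<Rightarrow> 'k::zero) \<Rightarrow> 'a set \<Rightarrow> 'a \<Rightarrow> 'a" where
  "proj ip S x = (THE p. p \<in> S \<and> x - p \<in> orthocomp ip S)"

(* The algebraic sum of U (i+1), ..., U m; addition of sets is that of Set_Algebras. *)
definition tail_sum :: "(nat \<Rightarrow> 'a::comm_monoid_add set) \<Rightarrow> nat \<Rightarrow> nat \<Rightarrow> 'a set" where
  "tail_sum U m i = (\<Sum>j\<in>{i+1..m}. U j)"

definition IBAP :: "('a::ab_group_add \<Rightarrow> 'a \<Rightarrow> 'k::zero) \<Rightarrow> (nat \<Rightarrow> 'a set) \<Rightarrow> nat \<Rightarrow> bool" where
  "IBAP ip U m \<longleftrightarrow>
     (\<forall>u. (\<forall>i\<in>{1..m}. u i \<in> U i) \<longrightarrow> (\<exists>x. \<forall>i\<in>{1..m}. proj ip (U i) x = u i))"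

definition independent_subspaces :: "(nat \<Rightarrow> 'a::comm_monoid_add set) \<Rightarrow> nat \<Rightarrow> bool" where
  "independent_subspaces U m \<longleftrightarrow>
     (\<forall>u. (\<forall>i\<in>{1..m}. u i \<in> U i) \<and> (\<Sum>i\<in>{1..m}. u i) = 0 \<longrightarrow> (\<forall>i\<in>{1..m}. u i = 0))"

definition cos_angle ::
  "('a::real_normed_vector \<Rightarrow> 'a \<Rightarrow> 'k::real_normed_field) \<Rightarrow> 'a set \<Rightarrow> 'a set \<Rightarrow> real" where
  "cos_angle ip U V = Sup {norm (ip x y) | x y.
     x \<in> U \<inter> orthocomp ip (U \<inter> V) \<and> y \<in> V \<inter> orthocomp ip (U \<inter> V) \<and> norm x \<le> 1 \<and> norm y \<le> 1}"

end

theory Submission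
  imports Defs
begin

text \<open>Everything is reduced to the angle between two subspaces: \<open>U i\<close> on one side, the sum \<open>T\<close> of the later
  subspaces on the other. The notion that all conditions are compared with is
  \<open>positive_angle\<close>: some \<open>k < 1\<close> satisfies \<open>\<langle>u, v\<rangle> \<le> k \<parallel>u\<parallel> \<parallel>v\<parallel>\<close> for all \<open>u\<close> and \<open>v\<close> in the two
  subspaces. It passes to closures, so \<open>T\<close> may be replaced by its closure.

  Let \<open>P\<^sub>U\<close> and \<open>P\<^sub>V\<close> be the projectors onto two closed subspaces \<open>U\<close> and \<open>V\<close>. By Pythagoras and
  Cauchy-Schwarz a positive angle is
  equivalent to \<open>\<parallel>P\<^sub>U P\<^sub>V\<parallel> < 1\<close>, to a lower bound for the projection of \<open>U\<close> onto the complement of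
  \<open>V\<close>, and to boundedness of the projection of \<open>U + V\<close> onto \<open>U\<close> along \<open>V\<close>. If the angle is positive,
  then \<open>P\<^sub>U\<close> maps the complement of \<open>V\<close> onto \<open>U\<close>, by the contraction principle, and \<open>U + V\<close> is closed.
  For the converses, both the surjectivity of \<open>P\<^sub>U\<close> on the complement
  of \<open>V\<close> (lemma \<open>positive_angle_iff_proj_image\<close>) and the closedness of \<open>U + V\<close> together with
  \<open>U \<inter> V = {0}\<close> (lemma \<open>positive_angle_if_closed_sum\<close>) lead to a positive angle by uniform
  boundedness, a consequence of Baire's theorem. The regularity estimate for distances follows from a positive angle
  and implies, by a contraction again, that \<open>U + V\<close> is closed (lemma \<open>closed_sum_if_regular\<close>).

  For a family, the inverse best approximation property is the surjectivity condition for each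
  \<open>U i\<close> and \<open>T\<close> (lemma \<open>IBAP_iff_stepwise\<close>): prescribed projections are attained by corrections made
  from the last subspace to the first. Linear independence says that \<open>U i\<close> meets \<open>T\<close> in zero
  only. In the conditions on closedness and on distances, closedness of \<open>T\<close> itself is
  obtained by descending induction (lemma \<open>closed_tails\<close>).

  Complex scalars reduce to real ones, since the real part of the inner product has the
  same orthogonal complements, and hence the same projectors, for sets stable under scalar
  multiplication.\<close>

section \<open>Algebraic sums of subspaces\<close>

lemma (in module) subspace_set_plus: "subspace S \<Longrightarrow> subspace T \<Longrightarrow> subspace (S + T)"
proof (rule subspaceI)
  assume S: "subspace S" and T: "subspace T"
  show "0 \<in> S + T" using set_plus_intro[OF subspace_0[OF S] subspace_0[OF T]] by simp
  fix x y assume "x \<in> S + T" "y \<in> S + T"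
  then obtain a b c d where x: "x = a + b" "a \<in> S" "b \<in> T" and y: "y = c + d" "c \<in> S" "d \<in> T"
    by (blast elim: set_plus_elim)
  have "(a + c) + (b + d) \<in> S + T"
    using x y S T by (intro set_plus_intro subspace_add) auto
  then show "x + y \<in> S + T" by (simp add: x(1) y(1) algebra_simps)
  fix r show "scale r x \<in> S + T"
    unfolding x(1) scale_right_distrib using x S T by (intro set_plus_intro subspace_scale) auto
qed

lemma (in module) subspace_set_sum:
  assumes "finite J" "\<And>j. j \<in> J \<Longrightarrow> subspace (S j)"
  shows "subspace (\<Sum>j\<in>J. S j)"
  using assms by (induction J rule: finite_induct) (simp_all add: set_zero subspace_set_plus)

section \<open>Orthogonal projections in a real Hilbert space\<close>

abbreviation closed_subspace :: "'a::real_normed_vector set \<Rightarrow> bool" where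
  "closed_subspace S \<equiv> subspace S \<and> closed S"

text \<open>The scalar field of a Hilbert space enters the theorem only through the sets that are stable under
  scalar multiplication, so the geometry is developed for a real inner product. The locale carries
  the inner product as a parameter because the type of vectors comes with a norm only; the inner
  product used later is the real part of the given one.\<close>

locale real_hilbert_space =
  fixes ip :: "'a::{real_normed_vector,complete_space} \<Rightarrow> 'a \<Rightarrow> real"
  assumes ip_add_left: "ip (x + y) z = ip x z + ip y z"
    and ip_scaleR_left: "ip (r *\<^sub>R x) y = r * ip x y"
    and ip_commute: "ip x y = ip y x"
    and ip_self: "ip x x = (norm x)\<^sup>2"
begin

lemma ip_add_right: "ip z (x + y) = ip z x + ip z y"
  by (metis ip_add_left ip_commute)

lemma ip_scaleR_right: "ip y (r *\<^sub>R x) = r * ip y x"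
  by (metis ip_scaleR_left ip_commute)

lemma ip_zero_left [simp]: "ip 0 y = 0"
  using ip_scaleR_left[of 0 0 y] by simp

lemma ip_zero_right [simp]: "ip y 0 = 0"
  using ip_scaleR_right[of y 0 0] by simp

lemma ip_minus_left: "ip (- x) y = - ip x y"
  using ip_scaleR_left[of "-1" x y] by simp

lemma ip_minus_right: "ip y (- x) = - ip y x"
  using ip_scaleR_right[of y "-1" x] by simp

lemma ip_diff_left: "ip (x - y) z = ip x z - ip y z"
  using ip_add_left[of x "- y" z] by (simp add: ip_minus_left)

lemma ip_diff_right: "ip z (x - y) = ip z x - ip z y"
  using ip_add_right[of z x "- y"] by (simp add: ip_minus_right)

lemmas ip_simps = ip_add_left ip_add_right ip_scaleR_left ip_scaleR_right
  ip_minus_left ip_minus_right ip_diff_left ip_diff_right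

lemma norm_add_sq: "(norm (x + y))\<^sup>2 = (norm x)\<^sup>2 + 2 * ip x y + (norm y)\<^sup>2"
  by (simp add: ip_simps ip_commute[of y x] flip: ip_self)

lemma norm_diff_sq: "(norm (x - y))\<^sup>2 = (norm x)\<^sup>2 - 2 * ip x y + (norm y)\<^sup>2"
  by (simp add: ip_simps ip_commute[of y x] flip: ip_self)

lemma Cauchy_Schwarz: "\<bar>ip x y\<bar> \<le> norm x * norm y"
proof (cases "x = 0 \<or> y = 0")
  case False
  then have nz: "norm x > 0" "norm y > 0" by auto
  let ?a = "x /\<^sub>R norm x" and ?b = "y /\<^sub>R norm y"
  have ab: "(norm ?a)\<^sup>2 = 1" "(norm ?b)\<^sup>2 = 1" using nz by auto
  have "0 \<le> (norm (?a + ?b))\<^sup>2" "0 \<le> (norm (?a - ?b))\<^sup>2" by auto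
  then have "\<bar>ip ?a ?b\<bar> \<le> 1" unfolding norm_add_sq norm_diff_sq ab by linarith
  then show ?thesis using nz by (simp add: ip_simps abs_mult field_simps)
qed auto

lemma ip_bounded_linear: "bounded_linear (\<lambda>x. ip x y)"
  by (rule bounded_linear_intro[where K="norm y"])
    (use Cauchy_Schwarz in \<open>auto simp: ip_simps\<close>)

lemma continuous_ip_left: "continuous_on UNIV (\<lambda>x. ip x y)"
  using ip_bounded_linear linear_continuous_on by blast

lemma subspace_orthocomp: "subspace (orthocomp ip S)"
  by (rule subspaceI) (auto simp: orthocomp_def ip_simps)

lemma closed_orthocomp: "closed (orthocomp ip S)"
proof -
  have "orthocomp ip S = (\<Inter>y\<in>S. {x. ip x y = 0})" by (auto simp: orthocomp_def)
  moreover have "closed {x. ip x y = 0}" for y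
    using closed_Collect_eq[OF continuous_ip_left[of y] continuous_on_const[of UNIV 0]] by simp
  ultimately show ?thesis by auto
qed

lemma closed_subspace_orthocomp: "closed_subspace (orthocomp ip S)"
  by (simp add: subspace_orthocomp closed_orthocomp)

lemma orthocomp_closure: "orthocomp ip (closure S) = orthocomp ip S"
proof
  show "orthocomp ip (closure S) \<subseteq> orthocomp ip S"
    using closure_subset[of S] by (auto simp: orthocomp_def)
  show "orthocomp ip S \<subseteq> orthocomp ip (closure S)"
  proof
    fix x assume "x \<in> orthocomp ip S"
    then have "S \<subseteq> orthocomp ip {x}" by (auto simp: orthocomp_def ip_commute)
    then have "closure S \<subseteq> orthocomp ip {x}" by (rule closure_minimal) (rule closed_orthocomp)
    then show "x \<in> orthocomp ip (closure S)" by (auto simp: orthocomp_def ip_commute)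
  qed
qed

lemma closed_subspace_closure: "subspace S \<Longrightarrow> closed_subspace (closure S)"
proof (intro conjI closed_closure subspaceI)
  assume S: "subspace S"
  show "0 \<in> closure S" using S closure_subset subspace_0 by blast
  fix x y assume "x \<in> closure S" "y \<in> closure S"
  then obtain f g where fg: "\<And>n. f n \<in> S" "f \<longlonglongrightarrow> x" "\<And>n. g n \<in> S" "g \<longlonglongrightarrow> y"
    unfolding closure_sequential by blast
  then have "\<And>n. f n + g n \<in> S" "(\<lambda>n. f n + g n) \<longlonglongrightarrow> x + y"
    using S by (auto intro: subspace_add tendsto_add)
  then show "x + y \<in> closure S"
    unfolding closure_sequential by (intro exI[of _ "\<lambda>n. f n + g n"]) simp
  fix c
  have "\<And>n. c *\<^sub>R f n \<in> S" "(\<lambda>n. c *\<^sub>R f n) \<longlonglongrightarrow> c *\<^sub>R x"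
    using S fg by (auto intro: subspace_scale tendsto_intros)
  then show "c *\<^sub>R x \<in> closure S"
    unfolding closure_sequential by (intro exI[of _ "\<lambda>n. c *\<^sub>R f n"]) simp
qed

text \<open>The parallelogram law makes every sequence in \<^term>\<open>S\<close> whose distances to \<^term>\<open>x\<close> approach
  the infimum a Cauchy sequence; its limit is a nearest point. At a nearest point the residual is
  orthogonal to \<^term>\<open>S\<close>, for otherwise a small step inside \<^term>\<open>S\<close> would come closer.\<close>

lemma projection_exists:
  assumes S: "closed_subspace S"
  shows "\<exists>p\<in>S. x - p \<in> orthocomp ip S"
proof -
  define d where "d = infdist x S"
  have S0: "0 \<in> S" using S subspace_0 by blast
  have d_le: "d\<^sup>2 \<le> (norm (x - s))\<^sup>2" if "s \<in> S" for s
    using infdist_le[OF that, of x] infdist_nonneg[of x S] by (auto simp: d_def dist_norm intro: power_mono)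
  have "\<exists>s\<in>S. (norm (x - s))\<^sup>2 < d\<^sup>2 + 1 / real (Suc n)" for n
  proof -
    have d0: "d \<ge> 0" by (simp add: d_def infdist_nonneg)
    have "sqrt (d\<^sup>2) < sqrt (d\<^sup>2 + 1 / real (Suc n))" by (simp only: real_sqrt_less_iff) simp
    then have "(INF s\<in>S. dist x s) < sqrt (d\<^sup>2 + 1 / real (Suc n))"
      using S0 d0 by (subst infdist_notempty[symmetric]) (auto simp: d_def)
    then obtain s where s: "s \<in> S" "dist x s < sqrt (d\<^sup>2 + 1 / real (Suc n))"
      using S0 by (auto dest!: cInf_lessD[rotated])
    then have "(norm (x - s))\<^sup>2 < (sqrt (d\<^sup>2 + 1 / real (Suc n)))\<^sup>2"
      by (intro power_strict_mono) (auto simp: dist_norm)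
    then show ?thesis using s by (auto simp: add_nonneg_nonneg)
  qed
  then obtain y where yS: "\<And>n. y n \<in> S" and y: "\<And>n. (norm (x - y n))\<^sup>2 < d\<^sup>2 + 1 / real (Suc n)"
    by metis
  \<comment> \<open>The midpoint of two points of \<^term>\<open>S\<close> is again at distance at least \<^term>\<open>d\<close> from \<^term>\<open>x\<close>.\<close>
  have mid: "(norm (y i - y j))\<^sup>2 \<le> 2 / real (Suc i) + 2 / real (Suc j)" for i j
  proof -
    have "(1/2) *\<^sub>R (y i + y j) \<in> S" using S yS by (intro subspace_scale subspace_add) auto
    from d_le[OF this]
    have "4 * d\<^sup>2 \<le> 4 * (norm (x - (1/2) *\<^sub>R (y i + y j)))\<^sup>2" by simp
    also have "\<dots> = (norm ((x - y i) + (x - y j)))\<^sup>2"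
    proof -
      have "(x - y i) + (x - y j) = 2 *\<^sub>R (x - (1/2) *\<^sub>R (y i + y j))"
        by (simp add: algebra_simps scaleR_2)
      then have "norm ((x - y i) + (x - y j)) = 2 * norm (x - (1/2) *\<^sub>R (y i + y j))"
        by (metis norm_scaleR abs_numeral)
      then show ?thesis by (simp add: power_mult_distrib)
    qed
    finally have *: "4 * d\<^sup>2 \<le> (norm ((x - y i) + (x - y j)))\<^sup>2" .
    have "(norm ((x - y j) - (x - y i)))\<^sup>2 = 2 * (norm (x - y i))\<^sup>2 + 2 * (norm (x - y j))\<^sup>2
            - (norm ((x - y i) + (x - y j)))\<^sup>2"
      unfolding norm_add_sq norm_diff_sq ip_commute[of "x - y j"] by simp
    then have "(norm (y i - y j))\<^sup>2 = 2 * (norm (x - y i))\<^sup>2 + 2 * (norm (x - y j))\<^sup>2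
            - (norm ((x - y i) + (x - y j)))\<^sup>2" by simp
    then show ?thesis using * y[of i] y[of j] by simp
  qed
  have "Cauchy y"
  proof (rule CauchyI)
    fix e :: real assume "0 < e"
    then obtain N where N: "1 / real (Suc N) < e\<^sup>2 / 4"
      using nat_approx_posE[of "e\<^sup>2/4"] by auto
    have "norm (y i - y j) < e" if "i \<ge> N" "j \<ge> N" for i j
    proof -
      have "1 / real (Suc i) \<le> 1 / real (Suc N)" "1 / real (Suc j) \<le> 1 / real (Suc N)"
        using that by (auto intro: divide_left_mono)
      then have "(norm (y i - y j))\<^sup>2 < e\<^sup>2" using mid[of i j] N by simp
      then show ?thesis using \<open>0 < e\<close> power2_less_imp_less by fastforce
    qed
    then show "\<exists>M. \<forall>m\<ge>M. \<forall>n\<ge>M. norm (y m - y n) < e" by blast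
  qed
  then obtain p where p: "y \<longlonglongrightarrow> p" using Cauchy_convergent convergent_def by blast
  have pS: "p \<in> S" using S yS p closed_sequentially by blast
  have "(\<lambda>n. (norm (x - y n))\<^sup>2) \<longlonglongrightarrow> (norm (x - p))\<^sup>2" by (intro tendsto_intros p)
  moreover have "(\<lambda>n. d\<^sup>2 + 1 / real (Suc n)) \<longlonglongrightarrow> d\<^sup>2 + 0"
    by (intro tendsto_intros LIMSEQ_Suc[OF lim_1_over_n])
  ultimately have "(norm (x - p))\<^sup>2 \<le> d\<^sup>2 + 0"
    by (rule LIMSEQ_le) (use y less_imp_le in blast)
  then have min: "(norm (x - p))\<^sup>2 \<le> (norm (x - s))\<^sup>2" if "s \<in> S" for s
    using d_le[OF that] by linarith
  have "ip (x - p) v = 0" if v: "v \<in> S" for v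
  proof (cases "v = 0")
    case False
    \<comment> \<open>The minimizer of \<open>t \<mapsto> \<parallel>x - p - t v\<parallel>\<close>, which must not improve on \<open>t = 0\<close>.\<close>
    define t where "t = ip (x - p) v / (norm v)\<^sup>2"
    have "p + t *\<^sub>R v \<in> S" using S pS v by (intro subspace_add subspace_scale) auto
    from min[OF this] have "(norm (x - p))\<^sup>2 \<le> (norm ((x - p) - t *\<^sub>R v))\<^sup>2" by (simp add: diff_diff_eq)
    then have "0 \<le> - 2 * (t * ip (x - p) v) + t\<^sup>2 * (norm v)\<^sup>2"
      unfolding norm_diff_sq[of "x - p"] by (simp add: ip_simps power_mult_distrib)
    also have "\<dots> = - (ip (x - p) v)\<^sup>2 / (norm v)\<^sup>2"
      using False by (simp add: t_def field_simps power2_eq_square)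
    finally have "(ip (x - p) v)\<^sup>2 / (norm v)\<^sup>2 \<le> 0" by simp
    then show ?thesis using False by (simp add: divide_le_0_iff)
  qed simp
  then show ?thesis using pS by (auto simp: orthocomp_def)
qed

lemma proj_eqI:
  assumes "subspace S" "p \<in> S" "x - p \<in> orthocomp ip S"
  shows "proj ip S x = p"
  unfolding proj_def
proof (rule the_equality)
  fix q assume q: "q \<in> S \<and> x - q \<in> orthocomp ip S"
  have "(x - p) - (x - q) \<in> orthocomp ip S"
    using q assms subspace_orthocomp subspace_diff by blast
  then have "q - p \<in> orthocomp ip S" by (simp add: algebra_simps)
  moreover have "q - p \<in> S" using q assms subspace_diff by blast
  ultimately have "ip (q - p) (q - p) = 0" by (auto simp: orthocomp_def)
  then show "q = p" by (simp add: ip_self)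
qed (use assms in auto)

lemma
  assumes "closed_subspace S"
  shows proj_mem: "proj ip S x \<in> S"
    and proj_residual: "x - proj ip S x \<in> orthocomp ip S"
proof -
  obtain p where "p \<in> S" "x - p \<in> orthocomp ip S" using projection_exists[OF assms] by blast
  moreover from this have "proj ip S x = p" using proj_eqI assms by blast
  ultimately show "proj ip S x \<in> S" "x - proj ip S x \<in> orthocomp ip S" by simp_all
qed

lemma proj_residual_ip: "closed_subspace S \<Longrightarrow> s \<in> S \<Longrightarrow> ip (x - proj ip S x) s = 0"
  using proj_residual by (auto simp: orthocomp_def)

lemma ip_proj_left: "closed_subspace S \<Longrightarrow> s \<in> S \<Longrightarrow> ip (proj ip S x) s = ip x s"
  using proj_residual_ip[of S s x] by (simp add: ip_simps)

lemma ip_proj_right: "closed_subspace S \<Longrightarrow> s \<in> S \<Longrightarrow> ip s (proj ip S x) = ip s x"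
  using ip_proj_left ip_commute by metis

lemma proj_idem: "closed_subspace S \<Longrightarrow> x \<in> S \<Longrightarrow> proj ip S x = x"
  by (rule proj_eqI) (auto simp: orthocomp_def)

lemma proj_add: "closed_subspace S \<Longrightarrow> proj ip S (x + y) = proj ip S x + proj ip S y"
  by (rule proj_eqI)
    (auto simp: orthocomp_def ip_add_left ip_diff_left ip_proj_left intro: subspace_add proj_mem)

lemma proj_scaleR: "closed_subspace S \<Longrightarrow> proj ip S (r *\<^sub>R x) = r *\<^sub>R proj ip S x"
  by (rule proj_eqI)
    (auto simp: orthocomp_def ip_diff_left ip_scaleR_left ip_proj_left intro: subspace_scale proj_mem)

lemma proj_diff: "closed_subspace S \<Longrightarrow> proj ip S (x - y) = proj ip S x - proj ip S y"
  using proj_add[of S "x - y" y] by simp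

lemma proj_eq_0_iff: "closed_subspace S \<Longrightarrow> proj ip S x = 0 \<longleftrightarrow> x \<in> orthocomp ip S"
  using proj_eqI[of S 0 x] proj_residual[of S x] subspace_0[of S] by auto

lemma ip_proj_self: "closed_subspace S \<Longrightarrow> ip x (proj ip S x) = (norm (proj ip S x))\<^sup>2"
  using ip_proj_left[of S "proj ip S x" x] by (simp add: proj_mem ip_self)

lemma norm_proj_Pythagoras:
  "closed_subspace S \<Longrightarrow> (norm x)\<^sup>2 = (norm (proj ip S x))\<^sup>2 + (norm (x - proj ip S x))\<^sup>2"
  using norm_diff_sq[of x "proj ip S x"] by (simp add: ip_proj_self)

lemma norm_proj_le: "closed_subspace S \<Longrightarrow> norm (proj ip S x) \<le> norm x"
  by (rule power2_le_imp_le) (simp_all add: norm_proj_Pythagoras[of S x])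

lemma bounded_linear_proj: "closed_subspace S \<Longrightarrow> bounded_linear (proj ip S)"
  by (rule bounded_linear_intro[where K=1]) (simp_all add: proj_add proj_scaleR norm_proj_le)

lemma proj_orthocomp: "closed_subspace S \<Longrightarrow> proj ip (orthocomp ip S) x = x - proj ip S x"
proof (rule proj_eqI[OF subspace_orthocomp proj_residual])
  assume "closed_subspace S"
  then have "proj ip S x \<in> S" by (rule proj_mem)
  then show "x - (x - proj ip S x) \<in> orthocomp ip (orthocomp ip S)"
    by (simp add: orthocomp_def ip_commute[of "proj ip S x"])
qed

lemma infdist_eq_norm_residual:
  assumes S: "closed_subspace S"
  shows "infdist x S = norm (x - proj ip S x)"
proof (rule antisym)
  show "infdist x S \<le> norm (x - proj ip S x)"
    using infdist_le[OF proj_mem[OF S], of x x] by (simp add: dist_norm)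
  have "norm (x - proj ip S x) \<le> dist x s" if s: "s \<in> S" for s
  proof -
    have "ip (x - proj ip S x) (proj ip S x - s) = 0"
      using S s by (intro proj_residual_ip subspace_diff proj_mem) auto
    then have "(norm ((x - proj ip S x) + (proj ip S x - s)))\<^sup>2
        = (norm (x - proj ip S x))\<^sup>2 + (norm (proj ip S x - s))\<^sup>2"
      unfolding norm_add_sq by simp
    then have "(norm (x - proj ip S x))\<^sup>2 \<le> (norm (x - s))\<^sup>2" by simp
    then show ?thesis unfolding dist_norm by (rule power2_le_imp_le) simp
  qed
  moreover have "S \<noteq> {}" using S subspace_0 by blast
  ultimately show "norm (x - proj ip S x) \<le> infdist x S"
    by (simp add: infdist_notempty cINF_greatest)
qed

lemma infdist_orthocomp: "closed_subspace S \<Longrightarrow> infdist x (orthocomp ip S) = norm (proj ip S x)"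
  using infdist_eq_norm_residual[OF closed_subspace_orthocomp, of x S] by (simp add: proj_orthocomp)

text \<open>The residual of any vector with respect to the closure is orthogonal to \<^term>\<open>S\<close>, hence zero.\<close>

lemma dense_if_orthocomp_trivial:
  assumes "subspace S" "orthocomp ip S \<subseteq> {0}"
  shows "closure S = UNIV"
proof -
  have C: "closed_subspace (closure S)" by (rule closed_subspace_closure[OF assms(1)])
  have "x \<in> closure S" for x
  proof -
    have "x - proj ip (closure S) x \<in> {0}"
      using proj_residual[OF C, of x] assms(2) unfolding orthocomp_closure by (rule subsetD[rotated])
    then have "x = proj ip (closure S) x" by simp
    then show ?thesis by (rule ssubst[where P="\<lambda>y. y \<in> closure S"]) (rule proj_mem[OF C])
  qed
  then show ?thesis by blast
qed

lemma orthocomp_orthocomp: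
  assumes S: "closed_subspace S"
  shows "orthocomp ip (orthocomp ip S) = S"
proof (rule equalityI; rule subsetI)
  fix x assume "x \<in> orthocomp ip (orthocomp ip S)"
  then have "proj ip (orthocomp ip S) x = 0"
    by (rule proj_eq_0_iff[OF closed_subspace_orthocomp, THEN iffD2])
  then have "x = proj ip S x" unfolding proj_orthocomp[OF S] by (rule eq_iff_diff_eq_0[THEN iffD2])
  then show "x \<in> S" by (rule ssubst[where P="\<lambda>y. y \<in> S"]) (rule proj_mem[OF S])
next
  fix x assume "x \<in> S"
  then show "x \<in> orthocomp ip (orthocomp ip S)" by (simp add: orthocomp_def ip_commute[of x])
qed

lemma subset_set_plus:
  assumes "subspace S" "subspace T"
  shows "S \<subseteq> S + T" "T \<subseteq> S + T"
  using set_zero_plus2[of T S] set_zero_plus2[of S T] assms by (simp_all add: subspace_0 add.commute)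

lemma orthocomp_set_plus:
  assumes "subspace S" "subspace T"
  shows "orthocomp ip (S + T) = orthocomp ip S \<inter> orthocomp ip T"
proof -
  have sub: "S \<subseteq> S + T" "T \<subseteq> S + T" using assms by (rule subset_set_plus)+
  show ?thesis
  proof (intro equalityI subsetI IntI)
    fix x assume "x \<in> orthocomp ip (S + T)"
    then show "x \<in> orthocomp ip S" "x \<in> orthocomp ip T" using sub by (auto simp: orthocomp_def)
  next
    fix x assume x: "x \<in> orthocomp ip S \<inter> orthocomp ip T"
    have "ip x y = 0" if "y \<in> S + T" for y
      using that by (rule set_plus_elim) (use x in \<open>simp add: orthocomp_def ip_add_right\<close>)
    then show "x \<in> orthocomp ip (S + T)" by (simp add: orthocomp_def)
  qed
qed

lemma orthocomp_set_sum:
  assumes "finite J" "\<And>j. j \<in> J \<Longrightarrow> subspace (S j)"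
  shows "orthocomp ip (\<Sum>j\<in>J. S j) = (\<Inter>j\<in>J. orthocomp ip (S j))"
  using assms
proof (induction J rule: finite_induct)
  case empty
  then show ?case by (simp add: set_zero orthocomp_def)
next
  case (insert j J)
  then show ?case by (simp add: real_vector.subspace_set_sum orthocomp_set_plus)
qed

section \<open>Uniform boundedness\<close>

text \<open>The Banach-Steinhaus theorem for functionals represented by vectors: the closed sets on which all
  functionals are bounded by a fixed natural number cover the space, so by Baire's theorem one of
  them contains a ball, and linearity turns a bound on a ball into a bound on the norms.\<close>

theorem uniform_boundedness:
  assumes "\<And>x. \<exists>C. \<forall>z\<in>F. \<bar>ip x z\<bar> \<le> C"
  shows "\<exists>M. \<forall>z\<in>F. norm z \<le> M"
proof -
  define A where "A n = {x. \<forall>z\<in>F. \<bar>ip x z\<bar> \<le> real n}" for n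
  have cl: "closed (A n)" for n
  proof -
    have "A n = (\<Inter>z\<in>F. {x. \<bar>ip x z\<bar> \<le> real n})" by (auto simp: A_def)
    moreover have "closed {x. \<bar>ip x z\<bar> \<le> real n}" for z
      by (intro closed_Collect_le continuous_on_rabs continuous_ip_left continuous_on_const)
    ultimately show ?thesis by auto
  qed
  have "\<exists>n. interior (A n) \<noteq> {}"
  proof (rule ccontr)
    assume "\<not> ?thesis"
    then have "(euclidean :: 'a topology) interior_of \<Union>(range A) = {}"
      by (intro Baire_category_alt) (auto simp: completely_metrizable_space_euclidean cl)
    moreover have "\<Union>(range A) = UNIV"
    proof -
      have "\<exists>n. x \<in> A n" for x
      proof -
        obtain C where C: "\<forall>z\<in>F. \<bar>ip x z\<bar> \<le> C" using assms by blast
        obtain n :: nat where "C \<le> real n" using real_arch_simple by blast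
        then show ?thesis using C by (intro exI[of _ n]) (force simp: A_def)
      qed
      then show ?thesis by auto
    qed
    ultimately show False by simp
  qed
  then obtain n x0 where "x0 \<in> interior (A n)" by auto
  then obtain r where r: "r > 0" "cball x0 r \<subseteq> A n"
    by (meson interior_subset mem_interior_cball order_trans)
  have "norm z \<le> 2 * real n / r" if z: "z \<in> F" for z
  proof (cases "z = 0")
    case False
    let ?w = "(r / norm z) *\<^sub>R z"
    have "x0 \<in> cball x0 r" "x0 + ?w \<in> cball x0 r" using r False by (auto simp: dist_norm)
    then have "x0 \<in> A n" "x0 + ?w \<in> A n" using r by blast+
    then have "\<bar>ip x0 z\<bar> \<le> real n" "\<bar>ip (x0 + ?w) z\<bar> \<le> real n" using z by (auto simp: A_def)
    then have "ip ?w z \<le> 2 * real n" by (simp add: ip_simps)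
    moreover have "ip ?w z = r * norm z" using False by (simp add: ip_simps ip_self power2_eq_square)
    ultimately show ?thesis using r by (simp add: field_simps)
  qed (use r in simp)
  then show ?thesis by blast
qed

text \<open>The homogeneous form in which the bound is applied below: each vector \<^term>\<open>z i\<close> has its own
  scale \<^term>\<open>q i\<close>, which may vanish (then so does \<^term>\<open>z i\<close>).\<close>

corollary uniform_boundedness_family:
  assumes q: "\<And>i. i \<in> I \<Longrightarrow> 0 \<le> q i"
    and bd: "\<And>x. \<exists>C. \<forall>i\<in>I. \<bar>ip x (z i)\<bar> \<le> C * q i"
  shows "\<exists>M\<ge>1. \<forall>i\<in>I. norm (z i) \<le> M * q i"
proof -
  define F where "F = {inverse (q i) *\<^sub>R z i | i. i \<in> I \<and> q i > 0}"
  have "\<exists>C. \<forall>f\<in>F. \<bar>ip x f\<bar> \<le> C" for x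
  proof -
    obtain C where C: "\<forall>i\<in>I. \<bar>ip x (z i)\<bar> \<le> C * q i" using bd by blast
    have "\<bar>ip x f\<bar> \<le> C" if f: "f \<in> F" for f
    proof -
      obtain i where i: "f = inverse (q i) *\<^sub>R z i" "i \<in> I" "q i > 0"
        using f unfolding F_def by blast
      have "\<bar>ip x (z i)\<bar> \<le> C * q i" using C i by blast
      then show ?thesis using i by (simp add: ip_simps abs_mult field_simps)
    qed
    then show ?thesis by blast
  qed
  then obtain M where M: "\<forall>f\<in>F. norm f \<le> M" using uniform_boundedness by blast
  have "norm (z i) \<le> max M 1 * q i" if i: "i \<in> I" for i
  proof (cases "q i = 0")
    case True
    obtain C where "\<forall>j\<in>I. \<bar>ip (z i) (z j)\<bar> \<le> C * q j" using bd by blast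
    then have "\<bar>ip (z i) (z i)\<bar> \<le> C * q i" using i by blast
    then show ?thesis using True by (simp add: ip_self)
  next
    case False
    then have qi: "q i > 0" using q[OF i] by simp
    then have "norm (inverse (q i) *\<^sub>R z i) \<le> M" using M i by (force simp: F_def)
    then have "norm (z i) \<le> M * q i" using qi by (simp add: field_simps)
    also have "\<dots> \<le> max M 1 * q i" using qi by (intro mult_right_mono) auto
    finally show ?thesis .
  qed
  then show ?thesis by (intro exI[of _ "max M 1"]) auto
qed

end

section \<open>Two subspaces at a positive angle\<close>

text \<open>The cosine of the minimal angle between the two subspaces is less than one. For subspaces the
  condition is symmetric under a change of sign of \<open>u\<close>, so it bounds absolute values as well. In
  contrast to \<^const>\<open>cos_angle\<close>, the intersection is not factored out: a positive angle forces the
  subspaces to meet in zero only.\<close>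

definition positive_angle :: "('a::real_normed_vector \<Rightarrow> 'a \<Rightarrow> real) \<Rightarrow> 'a set \<Rightarrow> 'a set \<Rightarrow> bool" where
  "positive_angle ip U V \<longleftrightarrow> (\<exists>k<1. \<forall>u\<in>U. \<forall>v\<in>V. ip u v \<le> k * norm u * norm v)"

context real_hilbert_space
begin

lemma positive_angleE:
  assumes "positive_angle ip U V"
  obtains k where "0 \<le> k" "k < 1" "\<And>u v. u \<in> U \<Longrightarrow> v \<in> V \<Longrightarrow> ip u v \<le> k * norm u * norm v"
proof -
  obtain k where k: "k < 1" "\<forall>u\<in>U. \<forall>v\<in>V. ip u v \<le> k * norm u * norm v"
    using assms by (auto simp: positive_angle_def)
  have "ip u v \<le> max k 0 * norm u * norm v" if "u \<in> U" "v \<in> V" for u v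
  proof -
    have "ip u v \<le> k * (norm u * norm v)" using k that by (simp add: mult.assoc)
    also have "\<dots> \<le> max k 0 * (norm u * norm v)" by (intro mult_right_mono) auto
    finally show ?thesis by (simp add: mult.assoc)
  qed
  then show ?thesis using that[of "max k 0"] k by auto
qed

lemma positive_angle_closure: "positive_angle ip U (closure V) \<longleftrightarrow> positive_angle ip U V"
proof
  assume "positive_angle ip U (closure V)"
  then show "positive_angle ip U V" using closure_subset unfolding positive_angle_def by blast
next
  assume "positive_angle ip U V"
  then obtain k where k: "k < 1" "\<And>u v. u \<in> U \<Longrightarrow> v \<in> V \<Longrightarrow> ip u v \<le> k * norm u * norm v"
    by (rule positive_angleE) blast
  have "ip u v \<le> k * norm u * norm v" if "u \<in> U" "v \<in> closure V" for u v
  proof -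
    have "closed {v. ip v u \<le> k * norm u * norm v}"
      by (intro closed_Collect_le continuous_ip_left continuous_intros)
    moreover have "V \<subseteq> {v. ip v u \<le> k * norm u * norm v}" using k that by (auto simp: ip_commute[of _ u])
    ultimately have "closure V \<subseteq> {v. ip v u \<le> k * norm u * norm v}" by (rule closure_minimal[rotated])
    then show ?thesis using that by (auto simp: ip_commute[of _ u])
  qed
  then show "positive_angle ip U (closure V)" using k(1) unfolding positive_angle_def by blast
qed

lemma positive_angle_imp_inter_trivial:
  assumes "positive_angle ip U V"
  shows "U \<inter> V \<subseteq> {0}"
proof
  fix x assume x: "x \<in> U \<inter> V"
  obtain k where "k < 1" "ip x x \<le> k * norm x * norm x"
    using assms x by (auto elim: positive_angleE)
  then have "(1 - k) * (norm x)\<^sup>2 \<le> 0" by (simp add: ip_self power2_eq_square algebra_simps)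
  then show "x \<in> {0}" using \<open>k < 1\<close> by (simp add: mult_le_0_iff)
qed

text \<open>By Pythagoras, bounding the component of \<open>u\<close> in \<^term>\<open>V\<close> by a factor less than one and bounding
  the component orthogonal to \<^term>\<open>V\<close> from below are the same, and the component of \<open>u\<close> in
  \<^term>\<open>V\<close> is governed by the inner products of \<open>u\<close> with vectors of \<^term>\<open>V\<close>.\<close>

lemma positive_angle_iff_bounded_below:
  assumes V: "closed_subspace V"
  shows "positive_angle ip U V \<longleftrightarrow>
    (\<exists>\<gamma>\<ge>1. \<forall>u\<in>U. norm u \<le> \<gamma> * norm (proj ip (orthocomp ip V) u))"
proof
  assume "positive_angle ip U V"
  then obtain k where k: "0 \<le> k" "k < 1" "\<And>u v. u \<in> U \<Longrightarrow> v \<in> V \<Longrightarrow> ip u v \<le> k * norm u * norm v"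
    by (rule positive_angleE) blast
  have "norm u \<le> 1 / (1 - k) * norm (proj ip (orthocomp ip V) u)" if u: "u \<in> U" for u
  proof -
    let ?p = "proj ip V u"
    have "norm ?p * norm ?p \<le> k * norm u * norm ?p"
      using k(3)[OF u proj_mem[OF V, of u]] by (simp add: ip_proj_self V power2_eq_square)
    then have "norm ?p \<le> k * norm u"
      using k(1) by (cases "?p = 0") auto
    moreover have "norm u \<le> norm ?p + norm (u - ?p)" using norm_triangle_ineq[of ?p "u - ?p"] by simp
    ultimately have "(1 - k) * norm u \<le> norm (u - ?p)" by (simp add: algebra_simps)
    then show ?thesis using k(2) by (simp add: proj_orthocomp V field_simps)
  qed
  then show "\<exists>\<gamma>\<ge>1. \<forall>u\<in>U. norm u \<le> \<gamma> * norm (proj ip (orthocomp ip V) u)"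
    using k by (intro exI[of _ "1 / (1 - k)"]) auto
next
  assume "\<exists>\<gamma>\<ge>1. \<forall>u\<in>U. norm u \<le> \<gamma> * norm (proj ip (orthocomp ip V) u)"
  then obtain \<gamma> where \<gamma>: "\<gamma> \<ge> 1" "\<And>u. u \<in> U \<Longrightarrow> norm u \<le> \<gamma> * norm (u - proj ip V u)"
    by (auto simp: proj_orthocomp V)
  define k where "k = sqrt (1 - 1 / \<gamma>\<^sup>2)"
  have g2: "0 < 1 / \<gamma>\<^sup>2" "1 / \<gamma>\<^sup>2 \<le> 1" using \<gamma>(1) by (auto simp: power_le_one_iff one_le_power)
  then have k: "0 \<le> k" "k < 1" "k\<^sup>2 = 1 - 1 / \<gamma>\<^sup>2" by (auto simp: k_def)
  have "ip u v \<le> k * norm u * norm v" if u: "u \<in> U" and v: "v \<in> V" for u v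
  proof -
    let ?p = "proj ip V u"
    have "(norm u)\<^sup>2 \<le> (\<gamma> * norm (u - ?p))\<^sup>2" using \<gamma>(2)[OF u] by (intro power_mono) auto
    then have "(norm u)\<^sup>2 / \<gamma>\<^sup>2 \<le> (norm (u - ?p))\<^sup>2"
      using \<gamma>(1) by (simp add: power_mult_distrib field_simps)
    then have "(norm ?p)\<^sup>2 \<le> (k * norm u)\<^sup>2"
      using norm_proj_Pythagoras[OF V, of u] by (simp add: k(3) power_mult_distrib left_diff_distrib)
    then have p: "norm ?p \<le> k * norm u" using k(1) by (intro power2_le_imp_le[of "norm ?p"]) auto
    have "ip u v = ip ?p v" using V v by (simp add: ip_proj_left)
    also have "\<dots> \<le> norm ?p * norm v" using Cauchy_Schwarz[of ?p v] by linarith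
    also have "\<dots> \<le> k * norm u * norm v" using p by (intro mult_right_mono) auto
    finally show ?thesis .
  qed
  then show "positive_angle ip U V" using k(2) by (auto simp: positive_angle_def)
qed

text \<open>The distance from \<open>u\<close> to \<^term>\<open>V\<close> is the least of the norms of \<open>u + v\<close>. So a positive angle
  means that the projection of \<open>U + V\<close> onto \<^term>\<open>U\<close> along \<^term>\<open>V\<close> is well defined and bounded.\<close>

lemma positive_angle_iff_component_bound:
  assumes V: "closed_subspace V"
  shows "positive_angle ip U V \<longleftrightarrow> (\<exists>\<gamma>\<ge>1. \<forall>u\<in>U. \<forall>v\<in>V. norm u \<le> \<gamma> * norm (u + v))"
  unfolding positive_angle_iff_bounded_below[OF V]
proof (intro arg_cong[of _ _ Ex] ext conj_cong refl iffI ballI)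
  fix \<gamma> u v assume \<gamma>: "1 \<le> \<gamma>" "\<forall>u\<in>U. norm u \<le> \<gamma> * norm (proj ip (orthocomp ip V) u)"
    and u: "u \<in> U" and v: "v \<in> V"
  have "proj ip (orthocomp ip V) u = (u + v) - proj ip V (u + v)"
    using V v by (simp add: proj_orthocomp proj_add proj_idem)
  also have "\<dots> = proj ip (orthocomp ip V) (u + v)" using V by (simp add: proj_orthocomp)
  finally have "norm (proj ip (orthocomp ip V) u) \<le> norm (u + v)"
    by (simp add: norm_proj_le[OF closed_subspace_orthocomp])
  then have "\<gamma> * norm (proj ip (orthocomp ip V) u) \<le> \<gamma> * norm (u + v)"
    using \<gamma>(1) by (intro mult_left_mono) auto
  then show "norm u \<le> \<gamma> * norm (u + v)" using \<gamma>(2) u by force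
next
  fix \<gamma> u assume \<gamma>: "\<forall>u\<in>U. \<forall>v\<in>V. norm u \<le> \<gamma> * norm (u + v)" and u: "u \<in> U"
  have "- proj ip V u \<in> V" using V proj_mem subspace_neg by blast
  then have "norm u \<le> \<gamma> * norm (u + - proj ip V u)" using \<gamma> u by blast
  then show "norm u \<le> \<gamma> * norm (proj ip (orthocomp ip V) u)" by (simp add: proj_orthocomp V)
qed

text \<open>Split \<open>x\<close> into its component in \<^term>\<open>U\<close>, to which the lower bound applies, and its residual,
  which costs one more unit in the constant: hence the step from \<open>\<gamma> \<ge> 1\<close> to \<open>\<gamma> \<ge> 2\<close>.\<close>

lemma positive_angle_iff_orthocomp_bound:
  assumes U: "closed_subspace U" and V: "closed_subspace V"
  shows "positive_angle ip U V \<longleftrightarrow>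
    (\<exists>\<gamma>\<ge>2. \<forall>x. norm x \<le>
       \<gamma> * (norm (proj ip (orthocomp ip U) x) + norm (proj ip (orthocomp ip V) x)))"
  unfolding positive_angle_iff_bounded_below[OF V]
proof
  assume "\<exists>\<gamma>\<ge>1. \<forall>u\<in>U. norm u \<le> \<gamma> * norm (proj ip (orthocomp ip V) u)"
  then obtain \<gamma> where \<gamma>: "\<gamma> \<ge> 1" "\<And>u. u \<in> U \<Longrightarrow> norm u \<le> \<gamma> * norm (proj ip (orthocomp ip V) u)"
    by blast
  let ?Q = "proj ip (orthocomp ip V)"
  have "norm x \<le> (\<gamma> + 1) * (norm (proj ip (orthocomp ip U) x) + norm (?Q x))" for x
  proof -
    let ?p = "proj ip U x" and ?r = "proj ip (orthocomp ip U) x"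
    have r: "?r = x - ?p" by (simp add: proj_orthocomp U)
    have "?Q ?p = ?Q x - ?Q ?r" unfolding r proj_diff[OF closed_subspace_orthocomp] by simp
    then have "norm (?Q ?p) \<le> norm (?Q x) + norm (?Q ?r)" by (simp add: norm_triangle_ineq4)
    also have "\<dots> \<le> norm (?Q x) + norm ?r" by (simp add: norm_proj_le[OF closed_subspace_orthocomp])
    finally have "\<gamma> * norm (?Q ?p) \<le> \<gamma> * (norm (?Q x) + norm ?r)"
      using \<gamma>(1) by (intro mult_left_mono) auto
    then have "norm ?p \<le> \<gamma> * (norm (?Q x) + norm ?r)" using \<gamma>(2)[OF proj_mem[OF U, of x]] by linarith
    moreover have "norm x \<le> norm ?p + norm ?r" using norm_triangle_ineq[of ?p ?r] by (simp add: r)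
    ultimately have "norm x \<le> \<gamma> * (norm (?Q x) + norm ?r) + norm ?r + norm (?Q x)"
      using norm_ge_zero[of "?Q x"] by linarith
    then show ?thesis by (simp only: distrib_left distrib_right mult_1)
  qed
  then show "\<exists>\<gamma>\<ge>2. \<forall>x. norm x \<le> \<gamma> * (norm (proj ip (orthocomp ip U) x) + norm (?Q x))"
    using \<gamma>(1) by (intro exI[of _ "\<gamma> + 1"]) auto
next
  assume "\<exists>\<gamma>\<ge>2. \<forall>x. norm x \<le> \<gamma> * (norm (proj ip (orthocomp ip U) x) + norm (proj ip (orthocomp ip V) x))"
  then obtain \<gamma> where \<gamma>: "\<gamma> \<ge> 2"
    "\<And>x. norm x \<le> \<gamma> * (norm (proj ip (orthocomp ip U) x) + norm (proj ip (orthocomp ip V) x))"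
    by blast
  have "norm u \<le> \<gamma> * norm (proj ip (orthocomp ip V) u)" if "u \<in> U" for u
    using \<gamma>(2)[of u] that U by (simp add: proj_orthocomp[OF U] proj_idem)
  then show "\<exists>\<gamma>\<ge>1. \<forall>u\<in>U. norm u \<le> \<gamma> * norm (proj ip (orthocomp ip V) u)"
    using \<gamma>(1) by (intro exI[of _ \<gamma>]) auto
qed

text \<open>Test the vector \<open>p\<close>, the projection onto \<^term>\<open>U\<close> of the projection of \<open>x\<close> onto \<^term>\<open>V\<close>,
  against itself: the square of its norm is an inner product of a vector of \<^term>\<open>U\<close> with one of
  \<^term>\<open>V\<close>.\<close>

lemma norm_proj_proj_le:
  assumes U: "closed_subspace U" and V: "closed_subspace V" and k: "0 \<le> k"
    "\<And>u v. u \<in> U \<Longrightarrow> v \<in> V \<Longrightarrow> ip u v \<le> k * norm u * norm v"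
  shows "norm (proj ip U (proj ip V x)) \<le> k * norm x"
proof -
  let ?p = "proj ip U (proj ip V x)"
  have "norm ?p * norm ?p = ip ?p (proj ip V x)"
    using ip_proj_self[OF U, of "proj ip V x"] by (simp add: ip_commute power2_eq_square)
  also have "\<dots> \<le> k * norm ?p * norm (proj ip V x)" by (intro k proj_mem U V)
  also have "\<dots> \<le> k * norm ?p * norm x" using k(1) by (intro mult_left_mono norm_proj_le V) auto
  finally show ?thesis using k(1) by (cases "?p = 0") auto
qed

lemma positive_angle_iff_onorm:
  assumes U: "closed_subspace U" and V: "closed_subspace V"
  shows "positive_angle ip U V \<longleftrightarrow> onorm (proj ip U \<circ> proj ip V) < 1"
proof
  assume "positive_angle ip U V"
  then obtain k where k: "0 \<le> k" "k < 1" "\<And>u v. u \<in> U \<Longrightarrow> v \<in> V \<Longrightarrow> ip u v \<le> k * norm u * norm v"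
    by (rule positive_angleE) blast
  have "onorm (proj ip U \<circ> proj ip V) \<le> k"
    by (rule onorm_bound[OF k(1)]) (simp add: norm_proj_proj_le[OF U V k(1,3)])
  then show "onorm (proj ip U \<circ> proj ip V) < 1" using k(2) by simp
next
  assume less: "onorm (proj ip U \<circ> proj ip V) < 1"
  have bl: "bounded_linear (proj ip U \<circ> proj ip V)"
    unfolding o_def by (rule bounded_linear_compose[OF bounded_linear_proj[OF U] bounded_linear_proj[OF V]])
  have "ip u v \<le> onorm (proj ip U \<circ> proj ip V) * norm u * norm v" if u: "u \<in> U" and v: "v \<in> V" for u v
  proof -
    have "ip u v = ip u (proj ip U (proj ip V v))"
      unfolding proj_idem[OF V v] ip_proj_right[OF U u] ..
    also have "\<dots> \<le> norm u * norm (proj ip U (proj ip V v))"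
      using Cauchy_Schwarz[of u "proj ip U (proj ip V v)"] by linarith
    also have "\<dots> \<le> norm u * (onorm (proj ip U \<circ> proj ip V) * norm v)"
      using onorm[OF bl, of v] by (intro mult_left_mono) auto
    also have "\<dots> = onorm (proj ip U \<circ> proj ip V) * norm u * norm v" by (simp only: mult_ac)
    finally show ?thesis .
  qed
  then show "positive_angle ip U V" using less unfolding positive_angle_def by blast
qed

text \<open>The orthogonal complement of \<^term>\<open>U\<close> is the kernel of the projector onto \<^term>\<open>U\<close>, so adding it
  to a set fills the space exactly when the projector maps that set onto \<^term>\<open>U\<close>.\<close>

lemma proj_image_orthocomp_iff_sum:
  assumes U: "closed_subspace U"
  shows "proj ip U ` orthocomp ip V = U \<longleftrightarrow> orthocomp ip U + orthocomp ip V = UNIV"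
proof
  assume im: "proj ip U ` orthocomp ip V = U"
  have "h \<in> orthocomp ip U + orthocomp ip V" for h
  proof -
    have "proj ip U h \<in> proj ip U ` orthocomp ip V" unfolding im by (rule proj_mem[OF U])
    then obtain x where x: "x \<in> orthocomp ip V" "proj ip U h = proj ip U x" by blast
    then have "proj ip U (h - x) = 0" by (simp add: proj_diff[OF U])
    then have "h - x \<in> orthocomp ip U" by (simp add: proj_eq_0_iff[OF U])
    from set_plus_intro[OF this x(1)] show ?thesis by simp
  qed
  then show "orthocomp ip U + orthocomp ip V = UNIV" by blast
next
  assume sum: "orthocomp ip U + orthocomp ip V = UNIV"
  show "proj ip U ` orthocomp ip V = U"
  proof (intro equalityI subsetI)
    fix u assume "u \<in> U"
    have "u \<in> orthocomp ip U + orthocomp ip V" using sum by simp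
    then obtain a b where ab: "u = a + b" "a \<in> orthocomp ip U" "b \<in> orthocomp ip V"
      by (auto elim: set_plus_elim)
    have "u = proj ip U u" using \<open>u \<in> U\<close> by (simp add: proj_idem[OF U])
    also have "\<dots> = proj ip U a + proj ip U b" unfolding ab(1) by (rule proj_add[OF U])
    also have "proj ip U a = 0" using ab(2) by (simp add: proj_eq_0_iff[OF U])
    finally show "u \<in> proj ip U ` orthocomp ip V" using ab(3) by (intro image_eqI[of _ _ b]) simp
  qed (use proj_mem[OF U] in auto)
qed

text \<open>If the angle is positive, then the composition of the two projectors is a strict contraction, and
  for \<open>u\<close> in \<^term>\<open>U\<close> the fixed point \<open>z\<close> of \<open>z \<mapsto> u + P\<^sub>U P\<^sub>V z\<close> gives the preimage
  \<open>z - P\<^sub>V z\<close> of \<open>u\<close>. Conversely, if the projector maps the complement of \<^term>\<open>V\<close> onto \<^term>\<open>U\<close>,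
  then every functional evaluated at \<open>u\<close> in \<^term>\<open>U\<close> only depends on the part of \<open>u\<close> orthogonal to
  \<^term>\<open>V\<close>, and uniform boundedness bounds \<open>u\<close> by that part.\<close>

lemma positive_angle_iff_proj_image:
  assumes U: "closed_subspace U" and V: "closed_subspace V"
  shows "positive_angle ip U V \<longleftrightarrow> proj ip U ` orthocomp ip V = U"
proof
  assume "positive_angle ip U V"
  then obtain k where k: "0 \<le> k" "k < 1" "\<And>u v. u \<in> U \<Longrightarrow> v \<in> V \<Longrightarrow> ip u v \<le> k * norm u * norm v"
    by (rule positive_angleE) blast
  show "proj ip U ` orthocomp ip V = U"
  proof (intro equalityI subsetI)
    fix u assume u: "u \<in> U"
    define f where "f z = u + proj ip U (proj ip V z)" for z
    have "dist (f y) (f z) \<le> k * dist y z" for y z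
      using norm_proj_proj_le[OF U V k(1,3), of "y - z"]
      by (simp add: f_def dist_norm proj_diff U V)
    then obtain z where z: "f z = z" using banach_fix_type[OF k(1,2), of f] by blast
    have zU: "z \<in> U"
      using z subspace_add[of U u] u U proj_mem[OF U, of "proj ip V z"] unfolding f_def by metis
    have "u = z - proj ip U (proj ip V z)" using z unfolding f_def by (simp add: eq_diff_eq)
    also have "\<dots> = proj ip U (z - proj ip V z)" using zU by (simp add: proj_diff[OF U] proj_idem[OF U])
    finally show "u \<in> proj ip U ` orthocomp ip V" using proj_residual[OF V, of z] by (rule image_eqI)
  qed (use proj_mem[OF U] in auto)
next
  assume im: "proj ip U ` orthocomp ip V = U"
  have "\<exists>C. \<forall>u\<in>U. \<bar>ip w u\<bar> \<le> C * norm (proj ip (orthocomp ip V) u)" for w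
  proof -
    have "proj ip U w \<in> proj ip U ` orthocomp ip V" unfolding im by (rule proj_mem[OF U])
    then obtain x where x: "x \<in> orthocomp ip V" "proj ip U w = proj ip U x" by blast
    have "\<bar>ip w u\<bar> \<le> norm x * norm (proj ip (orthocomp ip V) u)" if u: "u \<in> U" for u
    proof -
      have "ip w u = ip (proj ip U w) u" using u by (simp add: ip_proj_left[OF U])
      also have "\<dots> = ip x u" unfolding x(2) using u by (simp add: ip_proj_left[OF U])
      also have "\<dots> = ip x (proj ip (orthocomp ip V) u)"
        using x(1) by (simp add: ip_proj_right[OF closed_subspace_orthocomp])
      finally show ?thesis using Cauchy_Schwarz by simp
    qed
    then show ?thesis by blast
  qed
  then have "\<exists>\<gamma>\<ge>1. \<forall>u\<in>U. norm u \<le> \<gamma> * norm (proj ip (orthocomp ip V) u)"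
    using uniform_boundedness_family[of U "\<lambda>u. norm (proj ip (orthocomp ip V) u)" "\<lambda>u. u"] by simp
  then show "positive_angle ip U V" using positive_angle_iff_bounded_below[OF V] by blast
qed

text \<open>Since the projection along \<^term>\<open>V\<close> is bounded, the components of a convergent sequence in
  \<open>U + V\<close> converge as well.\<close>

lemma closed_sum_if_positive_angle:
  assumes U: "closed_subspace U" and V: "closed_subspace V" and "positive_angle ip U V"
  shows "closed (U + V)"
proof -
  obtain \<gamma> where \<gamma>: "\<gamma> \<ge> 1" "\<And>u v. u \<in> U \<Longrightarrow> v \<in> V \<Longrightarrow> norm u \<le> \<gamma> * norm (u + v)"
    using positive_angle_iff_component_bound[OF V, THEN iffD1, OF assms(3)] by blast
  show ?thesis
    unfolding closed_sequential_limits
  proof (intro allI impI, elim conjE)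
    fix w l assume w: "\<forall>n. w n \<in> U + V" and lim: "w \<longlonglongrightarrow> l"
    have "\<exists>u\<in>U. \<exists>v\<in>V. w n = u + v" for n
      using w[rule_format, of n] by (auto simp: set_plus_def)
    then obtain u v where uv: "\<And>n. u n \<in> U" "\<And>n. v n \<in> V" "\<And>n. w n = u n + v n" by metis
    have bound: "norm (u i - u j) \<le> \<gamma> * norm (w i - w j)" for i j
    proof -
      have "norm (u i - u j) \<le> \<gamma> * norm ((u i - u j) + (v i - v j))"
        using U V uv by (intro \<gamma>(2) subspace_diff) auto
      moreover have "(u i - u j) + (v i - v j) = w i - w j" by (simp add: uv(3))
      ultimately show ?thesis by simp
    qed
    have "Cauchy u"
    proof (rule CauchyI)
      fix e :: real assume "e > 0"
      then have "e / \<gamma> > 0" using \<gamma>(1) by simp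
      then obtain N where N: "\<forall>i\<ge>N. \<forall>j\<ge>N. norm (w i - w j) < e / \<gamma>"
        using CauchyD[OF LIMSEQ_imp_Cauchy[OF lim]] by blast
      have "norm (u i - u j) < e" if "i \<ge> N" "j \<ge> N" for i j
      proof -
        have "\<gamma> * norm (w i - w j) < e" using N that \<gamma>(1) by (simp add: field_simps)
        then show ?thesis using bound[of i j] by linarith
      qed
      then show "\<exists>N. \<forall>i\<ge>N. \<forall>j\<ge>N. norm (u i - u j) < e" by blast
    qed
    then obtain p where p: "u \<longlonglongrightarrow> p" using Cauchy_convergent convergent_def by blast
    have pU: "p \<in> U" using U uv(1) p closed_sequentially by blast
    have "(\<lambda>n. w n - u n) \<longlonglongrightarrow> l - p" by (intro tendsto_diff lim p)
    then have "v \<longlonglongrightarrow> l - p" by (simp add: uv(3))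
    then have "l - p \<in> V" using V uv(2) closed_sequentially by blast
    from set_plus_intro[OF pU this] show "l \<in> U + V" by simp
  qed
qed

text \<open>Boundedness of the projection \<open>Q\<close> of the Hilbert space \<open>W = U + V\<close> onto \<^term>\<open>U\<close> along
  \<^term>\<open>V\<close>, obtained from its adjoint instead of the closed graph theorem. The set \<open>I\<close> in the proof is
  the graph of the adjoint \<open>y \<mapsto> z\<close>: that \<open>z\<close> is orthogonal to \<^term>\<open>V\<close> and \<open>y - z\<close> to
  \<^term>\<open>U\<close> says that \<open>\<langle>u + v, z\<rangle> = \<langle>u, y\<rangle>\<close>. Uniform boundedness bounds the adjoint. Its domain is
  the sum of the two complements, which is dense because \<^term>\<open>U\<close> and \<^term>\<open>V\<close> meet only in
  zero, so the bound passes to \<open>Q\<close>.\<close>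

lemma positive_angle_if_closed_sum:
  assumes U: "closed_subspace U" and V: "closed_subspace V"
    and W: "closed (U + V)" and inter: "U \<inter> V \<subseteq> {0}"
  shows "positive_angle ip U V"
proof -
  have sW: "closed_subspace (U + V)" using U V W real_vector.subspace_set_plus by blast
  have UW: "U \<subseteq> U + V" "V \<subseteq> U + V"
    using subset_set_plus U V by blast+
  define I where "I = {(y, z). z \<in> orthocomp ip V \<and> z \<in> U + V \<and> y - z \<in> orthocomp ip U}"
  have "\<exists>C. \<forall>i\<in>I. \<bar>ip w (snd i)\<bar> \<le> C * norm (fst i)" for w
  proof -
    obtain u v where uv: "u \<in> U" "v \<in> V" "proj ip (U + V) w = u + v"
      using proj_mem[OF sW, of w] by (blast elim: set_plus_elim)
    have "\<bar>ip w z\<bar> \<le> norm u * norm y" if "(y, z) \<in> I" for y z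
    proof -
      have z: "z \<in> orthocomp ip V" "z \<in> U + V" "y - z \<in> orthocomp ip U" using that by (auto simp: I_def)
      have "ip w z = ip (u + v) z" using ip_proj_left[OF sW z(2), of w] uv(3) by simp
      also have "\<dots> = ip u z" using z(1) uv(2) by (simp add: ip_simps orthocomp_def ip_commute)
      also have "\<dots> = ip u y" using z(3) uv(1) by (simp add: ip_simps orthocomp_def ip_commute[of u])
      finally show ?thesis using Cauchy_Schwarz by simp
    qed
    then show ?thesis by (intro exI[of _ "norm u"]) auto
  qed
  then obtain M where M: "M \<ge> 1" "\<forall>i\<in>I. norm (snd i) \<le> M * norm (fst i)"
    using uniform_boundedness_family[of I "\<lambda>i. norm (fst i)" snd] by auto
  have dense: "closure (orthocomp ip U + orthocomp ip V) = UNIV"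
  proof (rule dense_if_orthocomp_trivial)
    show "orthocomp ip (orthocomp ip U + orthocomp ip V) \<subseteq> {0}"
      using inter U V by (simp add: orthocomp_set_plus subspace_orthocomp orthocomp_orthocomp)
  qed (intro real_vector.subspace_set_plus subspace_orthocomp)
  have "norm u \<le> M * norm (u + v)" if u: "u \<in> U" and v: "v \<in> V" for u v
  proof -
    have "orthocomp ip U + orthocomp ip V \<subseteq> {y. ip y u \<le> M * norm (u + v) * norm y}"
    proof
      fix y assume "y \<in> orthocomp ip U + orthocomp ip V"
      then obtain a b where ab: "a \<in> orthocomp ip U" "b \<in> orthocomp ip V" "y = a + b"
        by (blast elim: set_plus_elim)
      define z where "z = proj ip (U + V) b"
      have zW: "z \<in> U + V" unfolding z_def by (rule proj_mem[OF sW])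
      have zV: "z \<in> orthocomp ip V"
        using UW(2) ab(2) by (auto simp: z_def orthocomp_def ip_proj_left[OF sW])
      have yz: "y - z \<in> orthocomp ip U"
        using UW(1) ab(1) by (auto simp: z_def ab(3) orthocomp_def ip_simps ip_proj_left[OF sW])
      have "ip y u = ip z u" using yz u by (simp add: orthocomp_def ip_simps)
      also have "\<dots> = ip z (u + v)" using zV v by (simp add: orthocomp_def ip_simps)
      also have "\<dots> \<le> norm z * norm (u + v)" using Cauchy_Schwarz[of z "u + v"] by linarith
      also have "norm z \<le> M * norm y" using M(2) zV zW yz by (force simp: I_def)
      finally show "y \<in> {y. ip y u \<le> M * norm (u + v) * norm y}"
        by (simp add: mult_ac mult_right_mono)
    qed
    moreover have "closed {y. ip y u \<le> M * norm (u + v) * norm y}"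
      by (intro closed_Collect_le continuous_ip_left continuous_intros)
    ultimately have "closure (orthocomp ip U + orthocomp ip V) \<subseteq> {y. ip y u \<le> M * norm (u + v) * norm y}"
      by (rule closure_minimal)
    then have "ip u u \<le> M * norm (u + v) * norm u" using dense by blast
    then have "norm u * norm u \<le> (M * norm (u + v)) * norm u" by (simp add: ip_self power2_eq_square)
    then show ?thesis using M(1) by (cases "u = 0") auto
  qed
  then show ?thesis using M(1) positive_angle_iff_component_bound[OF V] by blast
qed

text \<open>The distance to the complement of a closed subspace is the norm of the projection onto the
  subspace. The projection \<open>w\<close> of \<open>x\<close> onto \<open>U + V\<close> splits as \<open>u + v\<close> with components bounded by
  multiples of \<open>w\<close>, and the square of its norm, which is \<open>\<langle>x, u\<rangle> + \<langle>x, v\<rangle>\<close>, sees only the projections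
  of \<open>x\<close> onto \<^term>\<open>U\<close> and \<^term>\<open>V\<close>.\<close>

lemma regular_if_positive_angle:
  assumes U: "closed_subspace U" and V: "closed_subspace V" and pos: "positive_angle ip U V"
  shows "\<exists>\<gamma>>0. \<forall>x. infdist x (orthocomp ip U \<inter> orthocomp ip V)
    \<le> \<gamma> * (infdist x (orthocomp ip U) + infdist x (orthocomp ip V))"
proof -
  obtain \<gamma> where \<gamma>: "\<gamma> \<ge> 1" "\<And>u v. u \<in> U \<Longrightarrow> v \<in> V \<Longrightarrow> norm u \<le> \<gamma> * norm (u + v)"
    using positive_angle_iff_component_bound[OF V, THEN iffD1, OF pos] by blast
  have sW: "closed_subspace (U + V)"
    using U V closed_sum_if_positive_angle[OF U V pos] real_vector.subspace_set_plus by blast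
  have inter: "orthocomp ip U \<inter> orthocomp ip V = orthocomp ip (U + V)"
    using U V by (simp add: orthocomp_set_plus)
  have "norm (proj ip (U + V) x) \<le> (1 + \<gamma>) * (norm (proj ip U x) + norm (proj ip V x))" for x
  proof -
    let ?w = "proj ip (U + V) x"
    obtain u v where uv: "u \<in> U" "v \<in> V" "?w = u + v"
      using proj_mem[OF sW, of x] by (blast elim: set_plus_elim)
    have u: "norm u \<le> \<gamma> * norm ?w" using \<gamma>(2)[OF uv(1,2)] by (simp add: uv(3))
    have "norm v \<le> norm ?w + norm u" using norm_triangle_ineq4[of ?w u] by (simp add: uv(3))
    then have v: "norm v \<le> (1 + \<gamma>) * norm ?w" using u by (simp add: algebra_simps)
    have u': "norm u \<le> (1 + \<gamma>) * norm ?w" using u by (simp add: algebra_simps add_increasing)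
    have "norm ?w * norm ?w = ip x (u + v)" using ip_proj_self[OF sW, of x] uv(3) by (simp add: power2_eq_square)
    also have "\<dots> = ip (proj ip U x) u + ip (proj ip V x) v"
      using uv by (simp add: ip_simps ip_proj_left[OF U] ip_proj_left[OF V])
    also have "\<dots> \<le> norm (proj ip U x) * norm u + norm (proj ip V x) * norm v"
      using Cauchy_Schwarz[of "proj ip U x" u] Cauchy_Schwarz[of "proj ip V x" v] by linarith
    also have "\<dots> \<le> norm (proj ip U x) * ((1 + \<gamma>) * norm ?w) + norm (proj ip V x) * ((1 + \<gamma>) * norm ?w)"
      by (intro add_mono mult_left_mono u' v) auto
    also have "\<dots> = ((1 + \<gamma>) * (norm (proj ip U x) + norm (proj ip V x))) * norm ?w"
      by (simp add: algebra_simps)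
    finally show ?thesis using \<gamma>(1) by (cases "?w = 0") auto
  qed
  then show ?thesis
    unfolding inter infdist_orthocomp[OF sW] infdist_orthocomp[OF U] infdist_orthocomp[OF V]
    using \<gamma>(1) by (intro exI[of _ "1 + \<gamma>"]) auto
qed

text \<open>The hypothesis says that the sum \<open>S\<close> of the two projectors is bounded below on the closure \<open>W\<close> of
  \<open>U + V\<close>. Being selfadjoint with \<open>0 \<le> S \<le> 2\<close>, it makes the identity minus half of \<open>S\<close> a strict
  contraction of \<open>W\<close>. So every \<open>w\<close> in \<open>W\<close> is half of \<open>S x\<close> for some \<open>x\<close>, hence lies in \<open>U + V\<close>.\<close>

lemma closed_sum_if_regular:
  assumes U: "closed_subspace U" and V: "closed_subspace V"
    and reg: "\<And>x. infdist x (orthocomp ip U \<inter> orthocomp ip V)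
      \<le> \<gamma> * (infdist x (orthocomp ip U) + infdist x (orthocomp ip V))"
  shows "closed (U + V)"
proof -
  define W where "W = closure (U + V)"
  have sUV: "subspace (U + V)" using U V real_vector.subspace_set_plus by blast
  have W: "closed_subspace W" unfolding W_def by (rule closed_subspace_closure[OF sUV])
  have UW: "U \<subseteq> W" "V \<subseteq> W"
    using subset_set_plus[of U V] U V closure_subset[of "U + V"] unfolding W_def by blast+
  have inter: "orthocomp ip U \<inter> orthocomp ip V = orthocomp ip W"
    using U V by (simp add: orthocomp_set_plus W_def orthocomp_closure)
  define g where "g = max \<gamma> 1"
  have g: "g \<ge> 1" by (simp add: g_def)
  define S where "S y = proj ip U y + proj ip V y" for y
  have S_diff: "S (y - z) = S y - S z" for y z by (simp add: S_def proj_diff U V)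
  \<comment> \<open>The constant comes from \<open>\<parallel>y - S y / 2\<parallel>\<^sup>2 \<le> \<parallel>y\<parallel>\<^sup>2 - \<langle>y, S y\<rangle> / 2\<close> and \<open>\<parallel>y\<parallel>\<^sup>2 \<le> 2 g\<^sup>2 \<langle>y, S y\<rangle>\<close>.\<close>
  define c where "c = sqrt (1 - 1 / (4 * g\<^sup>2))"
  have "g\<^sup>2 \<ge> 1" using g by (simp add: one_le_power)
  then have "0 < 1 / (4 * g\<^sup>2)" "1 / (4 * g\<^sup>2) \<le> 1" by (auto simp: divide_le_eq)
  then have c: "0 \<le> c" "c < 1" "c\<^sup>2 = 1 - 1 / (4 * g\<^sup>2)" by (auto simp: c_def)
  have contract: "norm (y - (1/2) *\<^sub>R S y) \<le> c * norm y" if y: "y \<in> W" for y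
  proof -
    let ?a = "norm (proj ip U y)" and ?b = "norm (proj ip V y)"
    have q: "ip y (S y) = ?a\<^sup>2 + ?b\<^sup>2" by (simp add: S_def ip_simps ip_proj_self U V)
    have ab: "(?a + ?b)\<^sup>2 \<le> 2 * (?a\<^sup>2 + ?b\<^sup>2)"
      using zero_le_power2[of "?a - ?b"] by (simp add: power2_eq_square algebra_simps)
    have "norm y \<le> \<gamma> * (?a + ?b)"
      using reg[of y] y unfolding inter infdist_orthocomp[OF W] infdist_orthocomp[OF U] infdist_orthocomp[OF V]
      by (simp add: proj_idem[OF W])
    also have "\<dots> \<le> g * (?a + ?b)" by (intro mult_right_mono) (auto simp: g_def)
    finally have "(norm y)\<^sup>2 \<le> (g * (?a + ?b))\<^sup>2" by (intro power_mono) auto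
    also have "\<dots> \<le> g\<^sup>2 * (2 * (?a\<^sup>2 + ?b\<^sup>2))"
      unfolding power_mult_distrib by (intro mult_left_mono ab) auto
    also have "\<dots> = (?a\<^sup>2 + ?b\<^sup>2) / 2 * (4 * g\<^sup>2)" by simp
    finally have low: "(norm y)\<^sup>2 / (4 * g\<^sup>2) \<le> (?a\<^sup>2 + ?b\<^sup>2) / 2"
      using g by (subst pos_divide_le_eq) auto
    have "norm (S y) \<le> ?a + ?b" unfolding S_def by (rule norm_triangle_ineq)
    then have "(norm (S y))\<^sup>2 \<le> (?a + ?b)\<^sup>2" by (intro power_mono) auto
    then have up: "(norm (S y))\<^sup>2 \<le> 2 * (?a\<^sup>2 + ?b\<^sup>2)" using ab by linarith
    have "(norm (y - (1/2) *\<^sub>R S y))\<^sup>2 = (norm y)\<^sup>2 - (?a\<^sup>2 + ?b\<^sup>2) + (norm (S y))\<^sup>2 / 4"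
    proof -
      have "2 * ip y ((1/2) *\<^sub>R S y) = ?a\<^sup>2 + ?b\<^sup>2" unfolding ip_scaleR_right q by simp
      moreover have "(norm ((1/2) *\<^sub>R S y))\<^sup>2 = (norm (S y))\<^sup>2 / 4" by (simp add: power_divide)
      ultimately show ?thesis unfolding norm_diff_sq[of y] by simp
    qed
    also have "\<dots> \<le> (norm y)\<^sup>2 - (norm y)\<^sup>2 / (4 * g\<^sup>2)"
    proof -
      have "t - s + r / 4 \<le> t - n" if "n \<le> s / 2" "r \<le> 2 * s" for n r s t :: real
        using that by linarith
      from this[OF low up] show ?thesis .
    qed
    also have "\<dots> = (c * norm y)\<^sup>2" by (simp only: power_mult_distrib c(3) left_diff_distrib) simp
    finally show ?thesis by (rule power2_le_imp_le) (simp add: c(1))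
  qed
  have "W \<subseteq> U + V"
  proof
    fix w assume w: "w \<in> W"
    define f where "f x = w + (x - (1/2) *\<^sub>R S x)" for x
    have "S x \<in> W" for x
      unfolding S_def
      using UW proj_mem[OF U, of x] proj_mem[OF V, of x] by (intro subspace_add[OF conjunct1[OF W]]) blast+
    then have "f x \<in> W" if "x \<in> W" for x
      unfolding f_def using W w that by (intro subspace_add subspace_diff subspace_scale) blast+
    then have "f ` W \<subseteq> W" by blast
    moreover have "dist (f x) (f y) \<le> c * dist x y" if "x \<in> W" "y \<in> W" for x y
    proof -
      have "f x - f y = (x - y) - (1/2) *\<^sub>R S (x - y)"
        unfolding f_def S_diff scaleR_diff_right by simp
      then show ?thesis
        using contract[OF subspace_diff[OF conjunct1[OF W] that]] by (simp only: dist_norm)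
    qed
    moreover have "complete W" using W by (simp add: complete_eq_closed)
    moreover have "W \<noteq> {}" using w by blast
    ultimately have "\<exists>!x\<in>W. f x = x" using c(1,2) by (intro Banach_fix)
    then obtain x where "f x = x" by blast
    then have "w = (1/2) *\<^sub>R S x" by (simp add: f_def)
    moreover have "S x \<in> U + V" unfolding S_def by (intro set_plus_intro proj_mem U V)
    ultimately show "w \<in> U + V" using sUV by (simp add: subspace_scale)
  qed
  then show ?thesis unfolding W_def by (simp only: closure_subset_eq)
qed

end

section \<open>Finite families of subspaces\<close>

locale closed_subspace_family = real_hilbert_space ip
  for ip :: "'a::{real_normed_vector,complete_space} \<Rightarrow> 'a \<Rightarrow> real" +
  fixes U :: "nat \<Rightarrow> 'a set" and m :: nat
  assumes m: "1 \<le> m"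
    and U: "\<And>i. i \<in> {1..m} \<Longrightarrow> closed_subspace (U i)"
begin

lemma zero_in_U: "i \<in> {1..m} \<Longrightarrow> 0 \<in> U i"
  using subspace_0[OF conjunct1[OF U]] .

lemma subspace_tail: "subspace (tail_sum U m i)"
  unfolding tail_sum_def by (rule real_vector.subspace_set_sum) (use U in auto)

lemma tail_step: "i < m \<Longrightarrow> tail_sum U m i = U (Suc i) + tail_sum U m (Suc i)"
  by (simp add: tail_sum_def sum.atLeast_Suc_atMost)

lemma tail_m: "tail_sum U m m = {0}"
  by (simp add: tail_sum_def set_zero)

lemma tail_eq: "tail_sum U m i = {\<Sum>j\<in>{i+1..m}. u j | u. \<forall>j\<in>{i+1..m}. u j \<in> U j}"
  unfolding tail_sum_def by (rule set_sum_alt) simp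

lemma orthocomp_tail:
  "x \<in> orthocomp ip (tail_sum U m i) \<longleftrightarrow> (\<forall>j\<in>{i+1..m}. proj ip (U j) x = 0)"
proof -
  have "orthocomp ip (tail_sum U m i) = (\<Inter>j\<in>{i+1..m}. orthocomp ip (U j))"
    unfolding tail_sum_def by (rule orthocomp_set_sum) (use U in auto)
  moreover have "x \<in> orthocomp ip (U j) \<longleftrightarrow> proj ip (U j) x = 0" if "j \<in> {i+1..m}" for j
    using proj_eq_0_iff[OF U, of j x] that by auto
  ultimately show ?thesis by simp
qed

text \<open>A solution for arbitrary prescribed projections is built from the last index down to the first:
  the correction made for \<^term>\<open>U i\<close> has zero projections onto all later subspaces and so leaves
  the projections already achieved unchanged. For the last index the prescribed vector of
  \<^term>\<open>U m\<close> itself serves as the correction.\<close>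

lemma IBAP_iff_stepwise:
  "IBAP ip U m \<longleftrightarrow>
    (\<forall>i\<in>{1..m-1}. \<forall>u\<in>U i. \<exists>x. proj ip (U i) x = u \<and> (\<forall>j\<in>{i+1..m}. proj ip (U j) x = 0))"
  (is "_ \<longleftrightarrow> ?step")
proof
  assume ibap: "IBAP ip U m"
  show ?step
  proof (intro ballI)
    fix i u assume i: "i \<in> {1..m-1}" and u: "u \<in> U i"
    have "\<forall>j\<in>{1..m}. (if j = i then u else 0) \<in> U j"
      using u zero_in_U by simp
    then obtain x where x: "\<forall>j\<in>{1..m}. proj ip (U j) x = (if j = i then u else 0)"
      using ibap[unfolded IBAP_def, rule_format, of "\<lambda>j. if j = i then u else 0"] by blast
    have "proj ip (U i) x = u \<and> (\<forall>j\<in>{i+1..m}. proj ip (U j) x = 0)"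
      using x i by auto
    then show "\<exists>x. proj ip (U i) x = u \<and> (\<forall>j\<in>{i+1..m}. proj ip (U j) x = 0)" by blast
  qed
next
  assume step: ?step
  have step': "\<exists>z. proj ip (U i) z = u \<and> (\<forall>j\<in>{i+1..m}. proj ip (U j) z = 0)"
    if "i \<in> {1..m}" "u \<in> U i" for i u
  proof (cases "i = m")
    case True
    then show ?thesis using proj_idem[OF U[OF that(1)] that(2)] by (intro exI[of _ u]) simp
  next
    case False
    then have "i \<in> {1..m-1}" using that by auto
    then show ?thesis using step that by blast
  qed
  show "IBAP ip U m"
    unfolding IBAP_def
  proof (intro allI impI)
    fix u assume u: "\<forall>i\<in>{1..m}. u i \<in> U i"
    have "\<exists>x. \<forall>j\<in>{i+1..m}. proj ip (U j) x = u j" if "i \<le> m" for i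
      using that
    proof (induction rule: inc_induct)
      case base
      then show ?case by simp
    next
      case (step i)
      then obtain x where x: "\<forall>j\<in>{Suc i+1..m}. proj ip (U j) x = u j" by blast
      have i: "Suc i \<in> {1..m}" using step by auto
      have "u (Suc i) - proj ip (U (Suc i)) x \<in> U (Suc i)"
        using u i U[OF i] proj_mem[OF U[OF i]] by (intro subspace_diff) auto
      from step'[OF i this] obtain z where z: "proj ip (U (Suc i)) z = u (Suc i) - proj ip (U (Suc i)) x"
        "\<forall>j\<in>{Suc i+1..m}. proj ip (U j) z = 0" by blast
      have "proj ip (U j) (x + z) = u j" if j: "j \<in> {i+1..m}" for j
      proof -
        have "proj ip (U j) (x + z) = proj ip (U j) x + proj ip (U j) z"
          using j by (intro proj_add U) auto
        then show ?thesis using x z j by (cases "j = Suc i") auto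
      qed
      then show ?case by blast
    qed
    from this[of 0] show "\<exists>x. \<forall>i\<in>{1..m}. proj ip (U i) x = u i" by simp
  qed
qed

lemma step_iff_proj_image:
  assumes i: "i \<in> {1..m}"
  shows "(\<forall>u\<in>U i. \<exists>x. proj ip (U i) x = u \<and> (\<forall>j\<in>{i+1..m}. proj ip (U j) x = 0)) \<longleftrightarrow>
    proj ip (U i) ` orthocomp ip (tail_sum U m i) = U i"
proof -
  have "proj ip (U i) ` orthocomp ip (tail_sum U m i) \<subseteq> U i" using proj_mem[OF U[OF i]] by blast
  then have "proj ip (U i) ` orthocomp ip (tail_sum U m i) = U i \<longleftrightarrow>
      (\<forall>u\<in>U i. u \<in> proj ip (U i) ` orthocomp ip (tail_sum U m i))" by blast
  also have "\<dots> \<longleftrightarrow> (\<forall>u\<in>U i. \<exists>x. proj ip (U i) x = u \<and> x \<in> orthocomp ip (tail_sum U m i))"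
    by (intro ball_cong refl) auto
  finally show ?thesis unfolding orthocomp_tail by blast
qed

lemma closed_subspace_closure_tail: "closed_subspace (closure (tail_sum U m i))"
  by (rule closed_subspace_closure[OF subspace_tail])

abbreviation positive_tail_angles :: bool where
  "positive_tail_angles \<equiv> \<forall>i\<in>{1..m-1}. positive_angle ip (U i) (tail_sum U m i)"

text \<open>A tail sum is not known to be closed, so the two-subspace results are applied to its closure,
  which has the same orthogonal complement and makes the same angle with \<^term>\<open>U i\<close>.\<close>

lemma positive_tail_angle_iff:
  assumes "i \<in> {1..m}"
  shows "positive_angle ip (U i) (tail_sum U m i) \<longleftrightarrow>
      proj ip (U i) ` orthocomp ip (tail_sum U m i) = U i"
    and "positive_angle ip (U i) (tail_sum U m i) \<longleftrightarrow>
      orthocomp ip (U i) + orthocomp ip (tail_sum U m i) = UNIV"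
    and "positive_angle ip (U i) (tail_sum U m i) \<longleftrightarrow>
      (\<exists>\<gamma>\<ge>1. \<forall>u\<in>U i. norm u \<le> \<gamma> * norm (proj ip (orthocomp ip (tail_sum U m i)) u))"
    and "positive_angle ip (U i) (tail_sum U m i) \<longleftrightarrow>
      (\<exists>\<gamma>\<ge>2. \<forall>x. norm x \<le> \<gamma> * (norm (proj ip (orthocomp ip (U i)) x)
        + norm (proj ip (orthocomp ip (tail_sum U m i)) x)))"
    and "positive_angle ip (U i) (tail_sum U m i) \<longleftrightarrow>
      onorm (proj ip (U i) \<circ> proj ip (closure (tail_sum U m i))) < 1"
proof -
  note V = closed_subspace_closure_tail[of i]
  note to_tail = positive_angle_closure orthocomp_closure
  show image: "positive_angle ip (U i) (tail_sum U m i) \<longleftrightarrow>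
      proj ip (U i) ` orthocomp ip (tail_sum U m i) = U i"
    by (rule positive_angle_iff_proj_image[OF U[OF assms] V, unfolded to_tail])
  show "positive_angle ip (U i) (tail_sum U m i) \<longleftrightarrow>
      orthocomp ip (U i) + orthocomp ip (tail_sum U m i) = UNIV"
    unfolding image by (rule proj_image_orthocomp_iff_sum[OF U[OF assms]])
  show "positive_angle ip (U i) (tail_sum U m i) \<longleftrightarrow>
      (\<exists>\<gamma>\<ge>1. \<forall>u\<in>U i. norm u \<le> \<gamma> * norm (proj ip (orthocomp ip (tail_sum U m i)) u))"
    by (rule positive_angle_iff_bounded_below[OF V, unfolded to_tail])
  show "positive_angle ip (U i) (tail_sum U m i) \<longleftrightarrow>
      (\<exists>\<gamma>\<ge>2. \<forall>x. norm x \<le> \<gamma> * (norm (proj ip (orthocomp ip (U i)) x)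
        + norm (proj ip (orthocomp ip (tail_sum U m i)) x)))"
    by (rule positive_angle_iff_orthocomp_bound[OF U[OF assms] V, unfolded to_tail])
  show "positive_angle ip (U i) (tail_sum U m i) \<longleftrightarrow>
      onorm (proj ip (U i) \<circ> proj ip (closure (tail_sum U m i))) < 1"
    by (rule positive_angle_iff_onorm[OF U[OF assms] V, unfolded to_tail])
qed

lemma IBAP_iff_positive_tail_angles: "IBAP ip U m \<longleftrightarrow> positive_tail_angles"
  unfolding IBAP_iff_stepwise
proof (intro ball_cong refl)
  fix i assume "i \<in> {1..m-1}"
  then have i: "i \<in> {1..m}" by auto
  show "(\<forall>u\<in>U i. \<exists>x. proj ip (U i) x = u \<and> (\<forall>j\<in>{i+1..m}. proj ip (U j) x = 0)) \<longleftrightarrow>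
    positive_angle ip (U i) (tail_sum U m i)"
    unfolding step_iff_proj_image[OF i] positive_tail_angle_iff(1)[OF i] ..
qed

text \<open>A vector common to \<^term>\<open>U i\<close> and the tail sum after \<^term>\<open>i\<close> is a nontrivial relation among
  the subspaces, unless it is zero. Conversely the terms of a relation vanish one after the other,
  starting with the first, each being minus the sum of the later ones.\<close>

lemma independent_iff_inter_trivial:
  "independent_subspaces U m \<longleftrightarrow> (\<forall>i\<in>{1..m-1}. U i \<inter> tail_sum U m i \<subseteq> {0})"
proof
  assume ind: "independent_subspaces U m"
  show "\<forall>i\<in>{1..m-1}. U i \<inter> tail_sum U m i \<subseteq> {0}"
  proof (intro ballI subsetI)
    fix i x assume i: "i \<in> {1..m-1}" and x: "x \<in> U i \<inter> tail_sum U m i"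
    then obtain u where u: "x = (\<Sum>j\<in>{i+1..m}. u j)" "\<forall>j\<in>{i+1..m}. u j \<in> U j"
      unfolding tail_eq by blast
    define w where "w j = (if j < i then 0 else if j = i then - x else u j)" for j
    have wU: "\<forall>j\<in>{1..m}. w j \<in> U j"
      using u(2) x i zero_in_U subspace_neg[OF conjunct1[OF U[of i]], of x] by (auto simp: w_def)
    have "(\<Sum>j\<in>{1..m}. w j) = (\<Sum>j\<in>{i..m}. w j)"
      using i by (intro sum.mono_neutral_right) (auto simp: w_def)
    also have "\<dots> = w i + (\<Sum>j\<in>{i+1..m}. w j)"
      using i by (subst sum.atLeast_Suc_atMost) auto
    also have "(\<Sum>j\<in>{i+1..m}. w j) = x"
      unfolding u(1) by (intro sum.cong) (auto simp: w_def)
    finally have "(\<Sum>j\<in>{1..m}. w j) = 0" by (simp add: w_def)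
    then have "\<forall>j\<in>{1..m}. w j = 0" using ind wU unfolding independent_subspaces_def by blast
    then have "w i = 0" using i by auto
    then show "x \<in> {0}" by (simp add: w_def)
  qed
next
  assume inter: "\<forall>i\<in>{1..m-1}. U i \<inter> tail_sum U m i \<subseteq> {0}"
  have inter': "U i \<inter> tail_sum U m i \<subseteq> {0}" if "i \<in> {1..m}" for i
  proof (cases "i = m")
    case False
    then have "i \<in> {1..m-1}" using that by auto
    then show ?thesis using inter by blast
  qed (simp add: tail_m)
  show "independent_subspaces U m"
    unfolding independent_subspaces_def
  proof (intro allI impI, elim conjE)
    fix u assume u: "\<forall>i\<in>{1..m}. u i \<in> U i" and sum: "(\<Sum>i\<in>{1..m}. u i) = 0"
    have zero: "u (Suc i) = 0 \<and> (\<Sum>j\<in>{Suc i + 1..m}. u j) = 0"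
      if i: "i < m" "(\<Sum>j\<in>{i+1..m}. u j) = 0" for i
    proof -
      let ?s = "\<Sum>j\<in>{Suc i + 1..m}. u j"
      have s: "u (Suc i) + ?s = 0" using i by (simp add: sum.atLeast_Suc_atMost)
      have "?s \<in> tail_sum U m (Suc i)" using u unfolding tail_eq by auto
      then have "- ?s \<in> tail_sum U m (Suc i)" using subspace_tail subspace_neg by blast
      moreover have "- ?s = u (Suc i)" by (rule eq_neg_iff_add_eq_0[THEN iffD2, OF s, symmetric])
      moreover have "u (Suc i) \<in> U (Suc i)" using u i by auto
      ultimately have "u (Suc i) = 0" using inter'[of "Suc i"] i by auto
      then show ?thesis using s by simp
    qed
    have tail: "i \<le> m \<Longrightarrow> (\<Sum>j\<in>{i+1..m}. u j) = 0" for i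
    proof (induction i)
      case 0
      then show ?case using sum by simp
    next
      case (Suc i)
      then show ?case using zero[of i] by simp
    qed
    show "\<forall>i\<in>{1..m}. u i = 0"
    proof
      fix i assume "i \<in> {1..m}"
      then obtain k where "i = Suc k" "k < m" by (cases i) auto
      then show "u i = 0" using zero[of k] tail[of k] by simp
    qed
  qed
qed

text \<open>Closedness climbs from the last tail sum to the first, because each tail sum is a sum of one
  subspace and the next tail sum.\<close>

lemma closed_tails:
  assumes "\<And>i. i \<in> {1..m-1} \<Longrightarrow> closed (tail_sum U m i) \<Longrightarrow> closed (U i + tail_sum U m i)"
  shows "i \<le> m \<Longrightarrow> closed (tail_sum U m i)"
proof (induction rule: inc_induct)
  case base
  then show ?case by (simp add: tail_m)
next
  case (step i)
  have "closed (U (Suc i) + tail_sum U m (Suc i))"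
  proof (cases "Suc i = m")
    case True
    have "U m + {0} = U m" by (simp add: set_plus_def)
    then show ?thesis using True U[of m] m by (simp add: tail_m)
  next
    case False
    then show ?thesis using step assms[of "Suc i"] by auto
  qed
  then show ?case using step tail_step[of i] by simp
qed

lemma positive_tail_angles_imp_independent:
  "positive_tail_angles \<Longrightarrow> independent_subspaces U m"
  unfolding independent_iff_inter_trivial using positive_angle_imp_inter_trivial by blast

lemma positive_tail_angles_iff_closed:
  "positive_tail_angles \<longleftrightarrow>
    independent_subspaces U m \<and> (\<forall>i\<in>{1..m-1}. closed (U i + tail_sum U m i))"
proof (intro iffI conjI; (elim conjE)?)
  assume pos: positive_tail_angles
  then show "independent_subspaces U m" by (rule positive_tail_angles_imp_independent)
  have sum: "closed (U i + tail_sum U m i)" if "i \<in> {1..m-1}" "closed (tail_sum U m i)" for i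
    using that pos subspace_tail by (intro closed_sum_if_positive_angle U) auto
  then show "\<forall>i\<in>{1..m-1}. closed (U i + tail_sum U m i)"
    using closed_tails[OF sum] by auto
next
  assume ind: "independent_subspaces U m" and cl: "\<forall>i\<in>{1..m-1}. closed (U i + tail_sum U m i)"
  show positive_tail_angles
  proof
    fix i assume i: "i \<in> {1..m-1}"
    have "closed (tail_sum U m i)" by (rule closed_tails) (use cl i in auto)
    then show "positive_angle ip (U i) (tail_sum U m i)"
      using ind[unfolded independent_iff_inter_trivial] cl i subspace_tail
      by (intro positive_angle_if_closed_sum U) auto
  qed
qed

lemma positive_tail_angles_iff_regular:
  "positive_tail_angles \<longleftrightarrow>
    independent_subspaces U m \<and>
    (\<forall>i\<in>{1..m-1}. \<exists>\<gamma>>0. \<forall>x. infdist x (orthocomp ip (U i) \<inter> orthocomp ip (tail_sum U m i))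
      \<le> \<gamma> * (infdist x (orthocomp ip (U i)) + infdist x (orthocomp ip (tail_sum U m i))))"
  (is "_ \<longleftrightarrow> _ \<and> (\<forall>i\<in>_. ?reg i)")
proof (intro iffI conjI; (elim conjE)?)
  assume pos: positive_tail_angles
  then show "independent_subspaces U m" by (rule positive_tail_angles_imp_independent)
  show "\<forall>i\<in>{1..m-1}. ?reg i"
  proof
    fix i assume i: "i \<in> {1..m-1}"
    then have "i \<in> {1..m}" by auto
    from regular_if_positive_angle[OF U[OF this] closed_subspace_closure_tail]
    show "?reg i" unfolding orthocomp_closure positive_angle_closure using pos i by blast
  qed
next
  assume ind: "independent_subspaces U m" and reg: "\<forall>i\<in>{1..m-1}. ?reg i"
  have sum: "closed (U i + tail_sum U m i)" if i: "i \<in> {1..m-1}" "closed (tail_sum U m i)" for i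
  proof -
    have im: "i \<in> {1..m}" using i by auto
    obtain \<gamma> where "\<And>x. infdist x (orthocomp ip (U i) \<inter> orthocomp ip (tail_sum U m i))
      \<le> \<gamma> * (infdist x (orthocomp ip (U i)) + infdist x (orthocomp ip (tail_sum U m i)))"
      using bspec[OF reg i(1)] by blast
    then show ?thesis by (rule closed_sum_if_regular[OF U[OF im] conjI[OF subspace_tail i(2)]])
  qed
  have "\<forall>i\<in>{1..m-1}. closed (U i + tail_sum U m i)"
    using sum closed_tails[OF sum] by auto
  then show positive_tail_angles unfolding positive_tail_angles_iff_closed using ind by blast
qed

end

section \<open>Reduction to real scalars\<close>

text \<open>On sets stable under scalar multiplication, orthogonality for the real part of the inner product
  is orthogonality for the inner product itself: replacing \<open>y\<close> by \<open>\<langle>x, y\<rangle> y\<close> turns the real part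
  into the square of the absolute value of \<open>\<langle>x, y\<rangle>\<close>. Hence complements, projectors and
  angles do not change.\<close>

definition re_ip :: "('a \<Rightarrow> 'a \<Rightarrow> 'k::real_or_complex) \<Rightarrow> 'a \<Rightarrow> 'a \<Rightarrow> real" where
  "re_ip ip x y = Re (to_complex (ip x y))"

lemma to_complex_0 [simp]: "to_complex 0 = 0"
  using norm_to_complex[of 0] by simp

lemma to_complex_of_real: "to_complex (of_real r :: 'k::real_or_complex) = of_real r"
proof -
  let ?e = "to_complex (1::'k)"
  have "norm ?e = 1" by (simp add: norm_to_complex)
  then have "?e \<noteq> 0" by auto
  moreover have "?e * ?e = ?e" using to_complex_mult[of "1::'k" 1] by simp
  ultimately have "?e = 1" by simp
  then show ?thesis by (simp add: of_real_def to_complex_scaleR)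
qed

context hilbert_space
begin

lemma re_ip_scaleR_left: "re_ip ip (r *\<^sub>R x) y = r * re_ip ip x y"
proof -
  have "ip (r *\<^sub>R x) y = of_real r * ip x y" by (simp add: ip_scale_left flip: scale_of_real)
  then show ?thesis by (simp add: re_ip_def to_complex_mult to_complex_of_real)
qed

lemma real_hilbert_space_re_ip: "real_hilbert_space (re_ip ip)"
proof
  show "re_ip ip (x + y) z = re_ip ip x z + re_ip ip y z" for x y z
    by (simp add: re_ip_def ip_add_left to_complex_add)
  show "re_ip ip (r *\<^sub>R x) y = r * re_ip ip x y" for r x y by (rule re_ip_scaleR_left)
  show "re_ip ip x y = re_ip ip y x" for x y
    by (simp add: re_ip_def ip_commute[of x y])
  show "re_ip ip x x = (norm x)\<^sup>2" for x
    unfolding re_ip_def ip_self to_complex_of_real by simp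
qed

lemma to_complex_ip_scale_right:
  "to_complex (ip x (scale a y)) = cnj (to_complex a) * to_complex (ip x y)"
proof -
  have "to_complex (ip x (scale a y)) = cnj (to_complex (ip (scale a y) x))" by (rule ip_commute)
  also have "\<dots> = cnj (to_complex a) * cnj (to_complex (ip y x))"
    by (simp add: ip_scale_left to_complex_mult)
  also have "cnj (to_complex (ip y x)) = to_complex (ip x y)" by (rule ip_commute[symmetric])
  finally show ?thesis .
qed

lemma norm_scale: "norm (scale a x) = norm a * norm x"
proof -
  have "complex_of_real ((norm (scale a x))\<^sup>2) = to_complex (ip (scale a x) (scale a x))"
    unfolding ip_self to_complex_of_real ..
  also have "\<dots> = (to_complex a * cnj (to_complex a)) * of_real ((norm x)\<^sup>2)"
    unfolding to_complex_ip_scale_right[of "scale a x"] unfolding ip_scale_left to_complex_mult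
    unfolding ip_self to_complex_of_real by simp
  also have "\<dots> = complex_of_real ((norm a * norm x)\<^sup>2)"
    by (simp add: norm_to_complex power_mult_distrib flip: complex_norm_square)
  finally have "(norm (scale a x))\<^sup>2 = (norm a * norm x)\<^sup>2" unfolding of_real_eq_iff .
  then show ?thesis by (simp add: power2_eq_iff_nonneg)
qed

lemma re_ip_scale_self: "re_ip ip x (scale (ip x y) y) = (norm (ip x y))\<^sup>2"
proof -
  have "to_complex (ip x (scale (ip x y) y)) = of_real ((norm (ip x y))\<^sup>2)"
    unfolding to_complex_ip_scale_right
    by (simp add: norm_to_complex mult.commute flip: complex_norm_square)
  then show ?thesis by (simp add: re_ip_def)
qed

lemma orthocomp_re_ip:
  assumes "\<And>a y. y \<in> S \<Longrightarrow> scale a y \<in> S"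
  shows "orthocomp (re_ip ip) S = orthocomp ip S"
proof (intro equalityI subsetI)
  fix x assume x: "x \<in> orthocomp (re_ip ip) S"
  have "ip x y = 0" if "y \<in> S" for y
  proof -
    have "re_ip ip x (scale (ip x y) y) = 0" using x assms[OF that] by (simp add: orthocomp_def)
    then show ?thesis unfolding re_ip_scale_self by simp
  qed
  then show "x \<in> orthocomp ip S" by (simp add: orthocomp_def)
qed (simp add: orthocomp_def re_ip_def)

lemma proj_re_ip:
  assumes "\<And>a y. y \<in> S \<Longrightarrow> scale a y \<in> S"
  shows "proj (re_ip ip) S = proj ip S"
  by (rule ext) (simp add: proj_def orthocomp_re_ip assms)

lemma scale_in_orthocomp: "x \<in> orthocomp ip S \<Longrightarrow> scale a x \<in> orthocomp ip S"
  by (simp add: orthocomp_def ip_scale_left)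

lemma scale_in_closure:
  assumes S: "\<And>a y. y \<in> S \<Longrightarrow> scale a y \<in> S" and y: "y \<in> closure S"
  shows "scale a y \<in> closure S"
proof -
  have "bounded_linear (scale a)"
  proof (rule bounded_linear_intro[where K="norm a"])
    show "scale a (r *\<^sub>R x) = r *\<^sub>R scale a x" for r x
      unfolding scale_of_real[symmetric] scale_scale by (simp add: mult.commute)
  qed (simp_all add: scale_right_distrib norm_scale)
  from closure_bounded_linear_image_subset[OF this, of S]
  have "scale a ` closure S \<subseteq> closure (scale a ` S)" .
  also have "\<dots> \<subseteq> closure S" using S by (intro closure_mono) auto
  finally show ?thesis using y by blast
qed

lemma norm_ip_le_if_re_ip_le:
  assumes V: "\<And>a v. v \<in> V \<Longrightarrow> scale a v \<in> V" and v: "v \<in> V" and k: "0 \<le> k"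
    and re: "\<And>v. v \<in> V \<Longrightarrow> re_ip ip u v \<le> k * norm u * norm v"
  shows "norm (ip u v) \<le> k * norm u * norm v"
proof -
  have "norm (ip u v) * norm (ip u v) \<le> (k * norm u * norm v) * norm (ip u v)"
    using re[OF V[OF v], of "ip u v"] unfolding re_ip_scale_self norm_scale
    by (simp add: power2_eq_square mult_ac)
  then show ?thesis using k by (cases "ip u v = 0") auto
qed

text \<open>As the intersection is zero, the defining supremum runs over the unit balls of \<^term>\<open>U\<close> and
  \<^term>\<open>V\<close>; normalizing vectors translates a bound on it into a bound for all pairs and back.\<close>

lemma cos_angle_less_1_iff:
  assumes U: "subspace U" and V: "subspace V" and inter: "U \<inter> V \<subseteq> {0}"
  shows "cos_angle ip U V < 1 \<longleftrightarrow> positive_angle (re_ip ip) U V"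
proof -
  interpret R: real_hilbert_space "re_ip ip" by (rule real_hilbert_space_re_ip)
  define C where "C = {norm (ip x y) | x y. x \<in> U \<and> y \<in> V \<and> norm x \<le> 1 \<and> norm y \<le> 1}"
  have zero: "0 \<in> U" "0 \<in> V" using U V by (auto intro: subspace_0)
  have ip0: "ip x 0 = 0" for x
    using norm_to_complex[of "ip x 0"] to_complex_ip_scale_right[of x 0 0] by simp
  have "U \<inter> V = {0}" using inter zero by blast
  then have ortho: "orthocomp ip (U \<inter> V) = UNIV" by (simp add: orthocomp_def ip0)
  have cos: "cos_angle ip U V = Sup C" unfolding cos_angle_def ortho C_def by simp
  have C0: "0 \<in> C"
    unfolding C_def using zero ip0 by (intro CollectI exI[of _ 0]) simp
  have bound: "norm (ip x y) \<le> k"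
    if x: "norm x \<le> 1" and y: "norm y \<le> 1" "y \<in> W" and k: "0 \<le> k"
      and W: "\<And>a v. v \<in> W \<Longrightarrow> scale a v \<in> W"
      and re: "\<And>v. v \<in> W \<Longrightarrow> re_ip ip x v \<le> k * norm x * norm v" for x y k W
  proof -
    have "norm (ip x y) \<le> k * norm x * norm y"
      by (rule norm_ip_le_if_re_ip_le[of W]) (use W y k re in auto)
    also have "\<dots> = k * (norm x * norm y)" by simp
    also have "\<dots> \<le> k * 1" using x y k by (intro mult_left_mono mult_le_one) auto
    finally show ?thesis by simp
  qed
  have bdd: "bdd_above C"
  proof (rule bdd_aboveI[of _ 1])
    fix c assume "c \<in> C"
    then obtain x y where xy: "c = norm (ip x y)" "norm x \<le> 1" "norm y \<le> 1" unfolding C_def by blast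
    have "re_ip ip x v \<le> 1 * norm x * norm v" for v
      using R.Cauchy_Schwarz[of x v] by simp
    then show "c \<le> 1" unfolding xy(1) using bound[of x y UNIV 1] xy(2,3) by simp
  qed
  show ?thesis
  proof
    assume less: "cos_angle ip U V < 1"
    have "re_ip ip u v \<le> Sup C * norm u * norm v" if u: "u \<in> U" and v: "v \<in> V" for u v
    proof (cases "u = 0 \<or> v = 0")
      case False
      let ?x = "u /\<^sub>R norm u" and ?y = "v /\<^sub>R norm v"
      have "?x \<in> U" "?y \<in> V" using u v U V by (metis scale_of_real subspace_scale)+
      then have "norm (ip ?x ?y) \<in> C" 
        unfolding C_def using False by (intro CollectI exI[of _ ?x] exI[of _ ?y]) simp
      then have "norm (ip ?x ?y) \<le> Sup C" by (rule cSup_upper[OF _ bdd])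
      moreover have "re_ip ip ?x ?y \<le> norm (ip ?x ?y)"
        unfolding re_ip_def using complex_Re_le_cmod[of "to_complex (ip ?x ?y)"] by (simp add: norm_to_complex)
      ultimately have "re_ip ip ?x ?y \<le> Sup C" by simp
      then show ?thesis using False by (simp add: R.ip_simps field_simps)
    qed auto
    then show "positive_angle (re_ip ip) U V"
      using less unfolding positive_angle_def cos by blast
  next
    assume "positive_angle (re_ip ip) U V"
    then obtain k where k: "0 \<le> k" "k < 1"
      "\<And>u v. u \<in> U \<Longrightarrow> v \<in> V \<Longrightarrow> re_ip ip u v \<le> k * norm u * norm v"
      by (rule R.positive_angleE) blast
    have "c \<le> k" if c: "c \<in> C" for c
    proof -
      obtain x y where xy: "c = norm (ip x y)" "x \<in> U" "y \<in> V" "norm x \<le> 1" "norm y \<le> 1"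
        using c unfolding C_def by blast
      show ?thesis
        unfolding xy(1)
        by (rule bound[of x y V]) (use xy V k subspace_scale in auto)
    qed
    then have "Sup C \<le> k" using C0 by (intro cSup_least) auto
    then show "cos_angle ip U V < 1" using k(2) cos by simp
  qed
qed

lemma real_subspace_if_subspace: "subspace S \<Longrightarrow> Real_Vector_Spaces.subspace S"
  by (rule Real_Vector_Spaces.subspaceI)
    (auto simp flip: scale_of_real intro: subspace_0 subspace_add subspace_scale)

end

section \<open>The characterizations of the inverse best approximation property\<close>

theorem theorem2p8:
  fixes scale :: "'k::real_or_complex \<Rightarrow> 'a::{real_normed_vector,complete_space} \<Rightarrow> 'a"
    and ip :: "'a \<Rightarrow> 'a \<Rightarrow> 'k"
    and U :: "nat \<Rightarrow> 'a set"
    and m :: nat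
  assumes "hilbert_space scale ip"
    and "m \<ge> 1"
    and "\<And>i. i \<in> {1..m} \<Longrightarrow> module.subspace scale (U i)"
    and "\<And>i. i \<in> {1..m} \<Longrightarrow> closed (U i)"
  shows
    "(IBAP ip U m \<longleftrightarrow>
       (\<forall>i\<in>{1..m-1}. \<forall>u\<in>U i. \<exists>x. proj ip (U i) x = u \<and> (\<forall>j\<in>{i+1..m}. proj ip (U j) x = 0))) \<and>
     (IBAP ip U m \<longleftrightarrow>
       (\<forall>i\<in>{1..m-1}. proj ip (U i) ` orthocomp ip (tail_sum U m i) = U i)) \<and>
     (IBAP ip U m \<longleftrightarrow>
       (\<forall>i\<in>{1..m-1}. orthocomp ip (U i) + orthocomp ip (tail_sum U m i) = UNIV)) \<and>
     (IBAP ip U m \<longleftrightarrow>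
       independent_subspaces U m \<and>
       (\<forall>i\<in>{1..m-1}. \<exists>\<gamma>>0. \<forall>x.
          infdist x (orthocomp ip (U i) \<inter> orthocomp ip (tail_sum U m i))
            \<le> \<gamma> * (infdist x (orthocomp ip (U i)) + infdist x (orthocomp ip (tail_sum U m i))))) \<and>
     (IBAP ip U m \<longleftrightarrow>
       independent_subspaces U m \<and> (\<forall>i\<in>{1..m-1}. closed (U i + tail_sum U m i))) \<and>
     (IBAP ip U m \<longleftrightarrow>
       independent_subspaces U m \<and> (\<forall>i\<in>{1..m-1}. cos_angle ip (U i) (tail_sum U m i) < 1)) \<and>
     (IBAP ip U m \<longleftrightarrow>
       (\<forall>i\<in>{1..m-1}. \<exists>\<gamma>\<ge>1. \<forall>u\<in>U i.
          norm u \<le> \<gamma> * norm (proj ip (orthocomp ip (tail_sum U m i)) u))) \<and>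
     (IBAP ip U m \<longleftrightarrow>
       (\<forall>i\<in>{1..m-1}. \<exists>\<gamma>\<ge>2. \<forall>x.
          norm x \<le> \<gamma> * (norm (proj ip (orthocomp ip (U i)) x)
            + norm (proj ip (orthocomp ip (tail_sum U m i)) x)))) \<and>
     (IBAP ip U m \<longleftrightarrow>
       (\<forall>i\<in>{1..m-1}. onorm (proj ip (U i) \<circ> proj ip (closure (tail_sum U m i))) < 1))"
proof -
  interpret hilbert_space scale ip by (rule assms(1))
  let ?re = "re_ip ip"
  interpret F: closed_subspace_family ?re U m
    by (intro closed_subspace_family.intro closed_subspace_family_axioms.intro
        real_hilbert_space_re_ip assms(2) conjI real_subspace_if_subspace assms(3,4))
  let ?T = "tail_sum U m"
  have idx: "i \<in> {1..m}" if "i \<in> {1..m-1}" for i using that by auto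
  have T: "subspace (?T i)" for i
    unfolding tail_sum_def by (rule subspace_set_sum) (simp_all add: assms(3))
  have scale_U: "scale a y \<in> U i" if "i \<in> {1..m}" "y \<in> U i" for a y i
    using subspace_scale[OF assms(3)[OF that(1)] that(2)] .
  have oU: "orthocomp ?re (U i) = orthocomp ip (U i)" and pU: "proj ?re (U i) = proj ip (U i)"
    if "i \<in> {1..m}" for i
    by (rule orthocomp_re_ip, erule scale_U[OF that]) (rule proj_re_ip, erule scale_U[OF that])
  have scale_T: "scale a y \<in> ?T i" if "y \<in> ?T i" for a y i
    using subspace_scale[OF T that] .
  have oT: "orthocomp ?re (?T i) = orthocomp ip (?T i)" for i
    by (rule orthocomp_re_ip) (rule scale_T)
  have po: "proj ?re (orthocomp ip S) = proj ip (orthocomp ip S)" for S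
    by (rule proj_re_ip) (rule scale_in_orthocomp)
  have pcT: "proj ?re (closure (?T i)) = proj ip (closure (?T i))" for i
    by (rule proj_re_ip, rule scale_in_closure, rule scale_T)
  have IBAP: "IBAP ip U m \<longleftrightarrow> F.positive_tail_angles"
    unfolding F.IBAP_iff_positive_tail_angles[symmetric] IBAP_def
    by (intro all_cong1 imp_cong ex_cong1 ball_cong refl) (simp add: pU)
  have IBAP_iff: "IBAP ip U m \<longleftrightarrow> (\<forall>i\<in>{1..m-1}. P i)"
    if "\<And>i. i \<in> {1..m} \<Longrightarrow> positive_angle ?re (U i) (?T i) \<longleftrightarrow> P i" for P
    unfolding IBAP by (intro ball_cong refl that idx)
  note angle_iff = F.positive_tail_angle_iff
  show ?thesis
  proof (intro conjI)
    show "IBAP ip U m \<longleftrightarrow> (\<forall>i\<in>{1..m-1}. \<forall>u\<in>U i. \<exists>x. proj ip (U i) x = u \<and>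
        (\<forall>j\<in>{i+1..m}. proj ip (U j) x = 0))"
    proof (rule IBAP_iff)
      fix i assume i: "i \<in> {1..m}"
      have tail: "(\<forall>j\<in>{i+1..m}. proj ?re (U j) x = 0) \<longleftrightarrow> (\<forall>j\<in>{i+1..m}. proj ip (U j) x = 0)"
        for x by (intro ball_cong refl) (simp add: pU)
      have "positive_angle ?re (U i) (?T i) \<longleftrightarrow>
          (\<forall>u\<in>U i. \<exists>x. proj ?re (U i) x = u \<and> (\<forall>j\<in>{i+1..m}. proj ?re (U j) x = 0))"
        unfolding angle_iff(1)[OF i] by (rule F.step_iff_proj_image[OF i, symmetric])
      then show "positive_angle ?re (U i) (?T i) \<longleftrightarrow>
          (\<forall>u\<in>U i. \<exists>x. proj ip (U i) x = u \<and> (\<forall>j\<in>{i+1..m}. proj ip (U j) x = 0))"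
        unfolding tail pU[OF i] .
    qed
    show "IBAP ip U m \<longleftrightarrow> (\<forall>i\<in>{1..m-1}. proj ip (U i) ` orthocomp ip (?T i) = U i)"
      by (rule IBAP_iff) (simp only: angle_iff(1) pU oT)
    show "IBAP ip U m \<longleftrightarrow> (\<forall>i\<in>{1..m-1}. orthocomp ip (U i) + orthocomp ip (?T i) = UNIV)"
      by (rule IBAP_iff) (simp only: angle_iff(2) oU oT)
    show "IBAP ip U m \<longleftrightarrow> (\<forall>i\<in>{1..m-1}. \<exists>\<gamma>\<ge>1. \<forall>u\<in>U i.
        norm u \<le> \<gamma> * norm (proj ip (orthocomp ip (?T i)) u))"
      by (rule IBAP_iff) (simp only: angle_iff(3) oT po)
    show "IBAP ip U m \<longleftrightarrow> (\<forall>i\<in>{1..m-1}. \<exists>\<gamma>\<ge>2. \<forall>x. norm x \<le>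
        \<gamma> * (norm (proj ip (orthocomp ip (U i)) x) + norm (proj ip (orthocomp ip (?T i)) x)))"
      by (rule IBAP_iff) (simp only: angle_iff(4) oU oT po)
    show "IBAP ip U m \<longleftrightarrow> (\<forall>i\<in>{1..m-1}. onorm (proj ip (U i) \<circ> proj ip (closure (?T i))) < 1)"
      by (rule IBAP_iff) (simp only: angle_iff(5) pU pcT)
    show "IBAP ip U m \<longleftrightarrow>
        independent_subspaces U m \<and> (\<forall>i\<in>{1..m-1}. closed (U i + ?T i))"
      unfolding IBAP by (rule F.positive_tail_angles_iff_closed)
    show "IBAP ip U m \<longleftrightarrow> independent_subspaces U m \<and>
        (\<forall>i\<in>{1..m-1}. \<exists>\<gamma>>0. \<forall>x. infdist x (orthocomp ip (U i) \<inter> orthocomp ip (?T i))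
          \<le> \<gamma> * (infdist x (orthocomp ip (U i)) + infdist x (orthocomp ip (?T i))))"
      unfolding IBAP F.positive_tail_angles_iff_regular
      by (intro conj_cong ball_cong refl) (simp only: oT oU[OF idx])
    show "IBAP ip U m \<longleftrightarrow>
        independent_subspaces U m \<and> (\<forall>i\<in>{1..m-1}. cos_angle ip (U i) (?T i) < 1)"
    proof -
      have "cos_angle ip (U i) (?T i) < 1 \<longleftrightarrow> positive_angle ?re (U i) (?T i)"
        if "independent_subspaces U m" "i \<in> {1..m-1}" for i
        using that(1)[unfolded F.independent_iff_inter_trivial] that(2)
        by (intro cos_angle_less_1_iff assms(3)[OF idx] T) auto
      then show ?thesis unfolding IBAP using F.positive_tail_angles_imp_independent by blast
    qed
  qed
qed

end
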